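(* Let $A$ be a left strongly Arens irregular Banach algebra and suppose that $A^{**}$ is an amenable Banach algebra. Then: (i) $A$ has an identity. (ii) If $A$ is a dual Banach algebra, then $A$ is reflexive.
   Context: $A^{**}$ carries the first Arens product: for $m,n\in A^{**}$, $f\in A^*$, $a,b\in A$, $\langle f.a,b\rangle=\langle f,ab\rangle$, $\langle m.f,a\rangle=\langle m,f.a\rangle$, $\langle m.n,f\rangle=\langle m,n.f\rangle$. The first topological center is $Z_1(A^{**})=\{m\in A^{**}: n\mapsto m.n \text{ is weak}^*\text{-weak}^* \text{ continuous on } A^{**}\}$; $A$ is left strongly Arens irregular if $Z_1(A^{**})=A$. A Banach algebra is amenable if every continuous derivation from it into the dual $B^*$ of any Banach bimodule $B$ is inner. A Banach $A$-bimodule $X$ is dual if there is a closed submodule $X_*$ of $X^*$ (a predual) with $X=(X_* )^*$; $A$ is a dual Banach algebra if it is dual as a Banach $A$-bimodule. *)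

theory Defs
  imports "HOL-Analysis.Analysis" "HOL-Algebra.Module"
begin

section \<open>Complex Banach spaces and Banach algebras\<close>

text \<open>
  Spaces are records with an explicit carrier, so that duals and biduals are spaces of the same
  kind and so that one can quantify over all Banach bimodules of an algebra.  The record extends
  that of modules, whose \<open>mult\<close> is used for algebras only; \<open>one\<close> is never used (Banach algebras
  are not assumed to be unital).
\<close>

record 'a normed_module = "(complex, 'a) module" +
  nrm :: "'a \<Rightarrow> real"

definition complex_ring :: "complex ring" where
  "complex_ring = \<lparr>carrier = UNIV, mult = (*), one = 1, zero = 0, add = (+)\<rparr>"

locale complex_normed_space = Module.module complex_ring X
  for X :: "'a normed_module" (structure) +
  assumes nrm_nonneg: "x \<in> carrier X \<Longrightarrow> 0 \<le> nrm X x"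
    and nrm_eq_zero: "x \<in> carrier X \<Longrightarrow> nrm X x = 0 \<longleftrightarrow> x = \<zero>"
    and nrm_triangle: "x \<in> carrier X \<Longrightarrow> y \<in> carrier X \<Longrightarrow> nrm X (x \<oplus> y) \<le> nrm X x + nrm X y"
    and nrm_scale: "x \<in> carrier X \<Longrightarrow> nrm X (c \<odot> x) = cmod c * nrm X x"

text \<open>The value outside the carrier is fixed because \<^locale>\<open>Metric_space\<close> demands
  nonnegativity and symmetry everywhere.\<close>

definition ndist :: "'a normed_module \<Rightarrow> 'a \<Rightarrow> 'a \<Rightarrow> real" where
  "ndist X x y = (if x \<in> carrier X \<and> y \<in> carrier X then nrm X (x \<ominus>\<^bsub>X\<^esub> y) else 0)"

locale banach_space = complex_normed_space +
  assumes complete: "Metric_space.mcomplete (carrier X) (ndist X)"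

locale banach_algebra = banach_space A for A :: "'a normed_module" (structure) +
  assumes mult_closed: "a \<in> carrier A \<Longrightarrow> b \<in> carrier A \<Longrightarrow> a \<otimes> b \<in> carrier A"
    and mult_assoc: "a \<in> carrier A \<Longrightarrow> b \<in> carrier A \<Longrightarrow> c \<in> carrier A \<Longrightarrow>
      (a \<otimes> b) \<otimes> c = a \<otimes> (b \<otimes> c)"
    and mult_add_left: "a \<in> carrier A \<Longrightarrow> b \<in> carrier A \<Longrightarrow> c \<in> carrier A \<Longrightarrow>
      (a \<oplus> b) \<otimes> c = a \<otimes> c \<oplus> b \<otimes> c"
    and mult_add_right: "a \<in> carrier A \<Longrightarrow> b \<in> carrier A \<Longrightarrow> c \<in> carrier A \<Longrightarrow>
      a \<otimes> (b \<oplus> c) = a \<otimes> b \<oplus> a \<otimes> c"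
    and mult_scale_left: "a \<in> carrier A \<Longrightarrow> b \<in> carrier A \<Longrightarrow> (z \<odot> a) \<otimes> b = z \<odot> (a \<otimes> b)"
    and mult_scale_right: "a \<in> carrier A \<Longrightarrow> b \<in> carrier A \<Longrightarrow> a \<otimes> (z \<odot> b) = z \<odot> (a \<otimes> b)"
    and nrm_mult: "a \<in> carrier A \<Longrightarrow> b \<in> carrier A \<Longrightarrow> nrm A (a \<otimes> b) \<le> nrm A a * nrm A b"


section \<open>Duals and weak* topologies\<close>

definition dual_carrier :: "'a normed_module \<Rightarrow> ('a \<Rightarrow> complex) set" where
  "dual_carrier X = {f \<in> extensional (carrier X).
     (\<forall>x\<in>carrier X. \<forall>y\<in>carrier X. f (x \<oplus>\<^bsub>X\<^esub> y) = f x + f y) \<and>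
     (\<forall>c. \<forall>x\<in>carrier X. f (c \<odot>\<^bsub>X\<^esub> x) = c * f x) \<and>
     (\<exists>K. \<forall>x\<in>carrier X. cmod (f x) \<le> K * nrm X x)}"

definition dual :: "'a normed_module \<Rightarrow> ('a \<Rightarrow> complex) normed_module" where
  "dual X = \<lparr>carrier = dual_carrier X, mult = undefined, one = undefined,
     zero = (\<lambda>x\<in>carrier X. 0),
     add = (\<lambda>f g. \<lambda>x\<in>carrier X. f x + g x),
     smult = (\<lambda>c f. \<lambda>x\<in>carrier X. c * f x),
     nrm = (\<lambda>f. SUP x\<in>{x \<in> carrier X. nrm X x \<le> 1}. cmod (f x))\<rparr>"

text \<open>The topology of pointwise convergence on the carrier of \<^term>\<open>dual X\<close>.\<close>

definition weak_star :: "'a normed_module \<Rightarrow> ('a \<Rightarrow> complex) topology" where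
  "weak_star X =
     subtopology (product_topology (\<lambda>_. euclidean) (carrier X)) (carrier (dual X))"

definition canonical_embedding :: "'a normed_module \<Rightarrow> 'a \<Rightarrow> ('a \<Rightarrow> complex) \<Rightarrow> complex" where
  "canonical_embedding X x = (\<lambda>f\<in>carrier (dual X). f x)"

definition reflexive :: "'a normed_module \<Rightarrow> bool" where
  "reflexive X \<longleftrightarrow> canonical_embedding X ` carrier X = carrier (dual (dual X))"


section \<open>The first Arens product\<close>

definition functional_act :: "'a normed_module \<Rightarrow> ('a \<Rightarrow> complex) \<Rightarrow> 'a \<Rightarrow> ('a \<Rightarrow> complex)" where
  "functional_act A f a = (\<lambda>b\<in>carrier A. f (a \<otimes>\<^bsub>A\<^esub> b))"

definition bidual_act ::
  "'a normed_module \<Rightarrow> (('a \<Rightarrow> complex) \<Rightarrow> complex) \<Rightarrow> ('a \<Rightarrow> complex) \<Rightarrow> ('a \<Rightarrow> complex)" where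
  "bidual_act A m f = (\<lambda>a\<in>carrier A. m (functional_act A f a))"

definition arens_mult ::
  "'a normed_module \<Rightarrow> (('a \<Rightarrow> complex) \<Rightarrow> complex) \<Rightarrow> (('a \<Rightarrow> complex) \<Rightarrow> complex)
    \<Rightarrow> (('a \<Rightarrow> complex) \<Rightarrow> complex)" where
  "arens_mult A m n = (\<lambda>f\<in>carrier (dual A). m (bidual_act A n f))"

definition bidual :: "'a normed_module \<Rightarrow> (('a \<Rightarrow> complex) \<Rightarrow> complex) normed_module" where
  "bidual A = (dual (dual A))\<lparr>mult := arens_mult A\<rparr>"

definition first_topological_center ::
  "'a normed_module \<Rightarrow> (('a \<Rightarrow> complex) \<Rightarrow> complex) set" where
  "first_topological_center A = {m \<in> carrier (bidual A).
     continuous_map (weak_star (dual A)) (weak_star (dual A)) (\<lambda>n. m \<otimes>\<^bsub>bidual A\<^esub> n)}"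

definition left_strongly_arens_irregular :: "'a normed_module \<Rightarrow> bool" where
  "left_strongly_arens_irregular A \<longleftrightarrow>
     first_topological_center A = canonical_embedding A ` carrier A"


section \<open>Banach bimodules, derivations, amenability\<close>

text \<open>\<open>l a x\<close> and \<open>r x a\<close> are the left and the right action of \<open>a\<close> on \<open>x\<close>.\<close>

locale banach_bimodule = banach_space X
  for A :: "'a normed_module" and X :: "'b normed_module" (structure)
    and l :: "'a \<Rightarrow> 'b \<Rightarrow> 'b" and r :: "'b \<Rightarrow> 'a \<Rightarrow> 'b" +
  assumes left_closed: "a \<in> carrier A \<Longrightarrow> x \<in> carrier X \<Longrightarrow> l a x \<in> carrier X"
    and right_closed: "a \<in> carrier A \<Longrightarrow> x \<in> carrier X \<Longrightarrow> r x a \<in> carrier X"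
    and left_add: "a \<in> carrier A \<Longrightarrow> x \<in> carrier X \<Longrightarrow> y \<in> carrier X \<Longrightarrow>
      l a (x \<oplus> y) = l a x \<oplus> l a y"
    and right_add: "a \<in> carrier A \<Longrightarrow> x \<in> carrier X \<Longrightarrow> y \<in> carrier X \<Longrightarrow>
      r (x \<oplus> y) a = r x a \<oplus> r y a"
    and left_add_alg: "a \<in> carrier A \<Longrightarrow> b \<in> carrier A \<Longrightarrow> x \<in> carrier X \<Longrightarrow>
      l (a \<oplus>\<^bsub>A\<^esub> b) x = l a x \<oplus> l b x"
    and right_add_alg: "a \<in> carrier A \<Longrightarrow> b \<in> carrier A \<Longrightarrow> x \<in> carrier X \<Longrightarrow>
      r x (a \<oplus>\<^bsub>A\<^esub> b) = r x a \<oplus> r x b"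
    and left_scale: "a \<in> carrier A \<Longrightarrow> x \<in> carrier X \<Longrightarrow> l a (z \<odot> x) = z \<odot> l a x"
    and right_scale: "a \<in> carrier A \<Longrightarrow> x \<in> carrier X \<Longrightarrow> r (z \<odot> x) a = z \<odot> r x a"
    and left_scale_alg: "a \<in> carrier A \<Longrightarrow> x \<in> carrier X \<Longrightarrow> l (z \<odot>\<^bsub>A\<^esub> a) x = z \<odot> l a x"
    and right_scale_alg: "a \<in> carrier A \<Longrightarrow> x \<in> carrier X \<Longrightarrow> r x (z \<odot>\<^bsub>A\<^esub> a) = z \<odot> r x a"
    and left_mult: "a \<in> carrier A \<Longrightarrow> b \<in> carrier A \<Longrightarrow> x \<in> carrier X \<Longrightarrow>
      l (a \<otimes>\<^bsub>A\<^esub> b) x = l a (l b x)"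
    and right_mult: "a \<in> carrier A \<Longrightarrow> b \<in> carrier A \<Longrightarrow> x \<in> carrier X \<Longrightarrow>
      r x (a \<otimes>\<^bsub>A\<^esub> b) = r (r x a) b"
    and left_right: "a \<in> carrier A \<Longrightarrow> b \<in> carrier A \<Longrightarrow> x \<in> carrier X \<Longrightarrow>
      r (l a x) b = l a (r x b)"
    and left_bounded: "\<exists>K. \<forall>a\<in>carrier A. \<forall>x\<in>carrier X. nrm X (l a x) \<le> K * nrm A a * nrm X x"
    and right_bounded: "\<exists>K. \<forall>a\<in>carrier A. \<forall>x\<in>carrier X. nrm X (r x a) \<le> K * nrm A a * nrm X x"

text \<open>The module actions on the dual: \<open>\<langle>a \<cdot> \<phi>, x\<rangle> = \<langle>\<phi>, x \<cdot> a\<rangle>\<close> and \<open>\<langle>\<phi> \<cdot> a, x\<rangle> = \<langle>\<phi>, a \<cdot> x\<rangle>\<close>.\<close>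

definition dual_left ::
  "'b normed_module \<Rightarrow> ('b \<Rightarrow> 'a \<Rightarrow> 'b) \<Rightarrow> 'a \<Rightarrow> ('b \<Rightarrow> complex) \<Rightarrow> ('b \<Rightarrow> complex)" where
  "dual_left X r a \<phi> = (\<lambda>x\<in>carrier X. \<phi> (r x a))"

definition dual_right ::
  "'b normed_module \<Rightarrow> ('a \<Rightarrow> 'b \<Rightarrow> 'b) \<Rightarrow> ('b \<Rightarrow> complex) \<Rightarrow> 'a \<Rightarrow> ('b \<Rightarrow> complex)" where
  "dual_right X l \<phi> a = (\<lambda>x\<in>carrier X. \<phi> (l a x))"

definition continuous_derivation ::
  "'a normed_module \<Rightarrow> 'b normed_module \<Rightarrow> ('a \<Rightarrow> 'b \<Rightarrow> 'b) \<Rightarrow> ('b \<Rightarrow> 'a \<Rightarrow> 'b) \<Rightarrow> ('a \<Rightarrow> 'b) \<Rightarrow> bool"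
where
  "continuous_derivation A X l r D \<longleftrightarrow>
     D \<in> carrier A \<rightarrow> carrier X \<and>
     (\<forall>a\<in>carrier A. \<forall>b\<in>carrier A. D (a \<oplus>\<^bsub>A\<^esub> b) = D a \<oplus>\<^bsub>X\<^esub> D b) \<and>
     (\<forall>z. \<forall>a\<in>carrier A. D (z \<odot>\<^bsub>A\<^esub> a) = z \<odot>\<^bsub>X\<^esub> D a) \<and>
     (\<exists>K. \<forall>a\<in>carrier A. nrm X (D a) \<le> K * nrm A a) \<and>
     (\<forall>a\<in>carrier A. \<forall>b\<in>carrier A. D (a \<otimes>\<^bsub>A\<^esub> b) = l a (D b) \<oplus>\<^bsub>X\<^esub> r (D a) b)"

definition inner_derivation ::
  "'a normed_module \<Rightarrow> 'b normed_module \<Rightarrow> ('a \<Rightarrow> 'b \<Rightarrow> 'b) \<Rightarrow> ('b \<Rightarrow> 'a \<Rightarrow> 'b) \<Rightarrow> ('a \<Rightarrow> 'b) \<Rightarrow> bool"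
where
  "inner_derivation A X l r D \<longleftrightarrow>
     (\<exists>x\<in>carrier X. \<forall>a\<in>carrier A. D a = l a x \<ominus>\<^bsub>X\<^esub> r x a)"

text \<open>
  HOL cannot quantify over all types inside a formula, so the elements of the bimodules range over
  the fixed type \<^typ>\<open>'a \<Rightarrow> 'a \<Rightarrow> complex\<close>; carrier, operations and norm are arbitrary.  Up to
  isomorphism these are all Banach bimodules whose cardinality is at most that of this type, and
  for a Banach algebra \<open>A\<close> they suffice: the bimodules from which one obtains a bounded approximate
  identity and then a virtual diagonal for \<open>A\<close> are \<open>A\<^sup>*\<close> and a quotient of the space of bounded
  bilinear forms on \<open>A \<times> A\<close>, both of which are of that size, and a virtual diagonal makes every
  continuous derivation into a dual bimodule inner.
\<close>

definition amenable :: "'a normed_module \<Rightarrow> bool" where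
  "amenable A \<longleftrightarrow>
     (\<forall>(B :: ('a \<Rightarrow> 'a \<Rightarrow> complex) normed_module) l r D.
        banach_bimodule A B l r \<longrightarrow>
        continuous_derivation A (dual B) (dual_left B r) (dual_right B l) D \<longrightarrow>
        inner_derivation A (dual B) (dual_left B r) (dual_right B l) D)"


section \<open>Dual Banach algebras\<close>

text \<open>
  A predual is a closed submodule \<open>F\<close> of the dual of \<open>X\<close> such that the canonical map from \<open>X\<close> to
  the dual of \<open>F\<close> is an isomorphism of Banach spaces.  It is always contractive; it is not required
  to be isometric.
\<close>

definition is_predual ::
  "'a normed_module \<Rightarrow> 'b normed_module \<Rightarrow> ('a \<Rightarrow> 'b \<Rightarrow> 'b) \<Rightarrow> ('b \<Rightarrow> 'a \<Rightarrow> 'b) \<Rightarrow> ('b \<Rightarrow> complex) set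
    \<Rightarrow> bool" where
  "is_predual A X l r F \<longleftrightarrow>
     submodule F complex_ring (dual X) \<and>
     closedin (Metric_space.mtopology (carrier (dual X)) (ndist (dual X))) F \<and>
     (\<forall>a\<in>carrier A. \<forall>f\<in>F. dual_left X r a f \<in> F \<and> dual_right X l f a \<in> F) \<and>
     (let F' = (dual X)\<lparr>carrier := F\<rparr>; \<iota> = (\<lambda>x. \<lambda>f\<in>F. f x) in
        bij_betw \<iota> (carrier X) (carrier (dual F')) \<and>
        (\<exists>K. \<forall>x\<in>carrier X. nrm X x \<le> K * nrm (dual F') (\<iota> x)))"

definition dual_bimodule ::
  "'a normed_module \<Rightarrow> 'b normed_module \<Rightarrow> ('a \<Rightarrow> 'b \<Rightarrow> 'b) \<Rightarrow> ('b \<Rightarrow> 'a \<Rightarrow> 'b) \<Rightarrow> bool" where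
  "dual_bimodule A X l r \<longleftrightarrow> banach_bimodule A X l r \<and> (\<exists>F. is_predual A X l r F)"

definition dual_banach_algebra :: "'a normed_module \<Rightarrow> bool" where
  "dual_banach_algebra A \<longleftrightarrow> dual_bimodule A A (mult A) (mult A)"

end

(*  Let A' be the dual and A'' the second dual of A.  Let I be an ideal of A'' that is the
    annihilator of a subset of A' and the kernel of a bounded homomorphism pi of A'' onto a complement
    of I.  The map n - pi n is a derivation into I when A'' acts on I through pi on one side; by
    amenability it is inner in the second dual of I, and the element implementing it, restricted to
    A', gives a left identity p of I.  With pi acting on the other side, one gets i = i p for i in I.
    Such a p is central, so that the map n -> p n = n p is continuous for the weak star topology and
    p lies in A.  For I = A'' this p is the identity of A.  If F is a predual of A and I is its
    annihilator, then p, as an element of A that vanishes on F, is 0; hence I = 0 and A'' = A.  *)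

theory Submission
  imports Defs
begin

section \<open>Complex normed spaces\<close>

text \<open>The obstacle is that the first Arens product is weak-star continuous in its left factor
  only. Left multiplications on I need not be weak-star continuous, so I itself is not treated as a
  dual bimodule. The derivations take values in the second dual of I, which is the dual of the
  bimodule I', and something has to be brought back into A''. Restriction to A' does this for a left
  identity, because n -> n i is the continuous side. On the other side only a cancellation is
  extracted: an element i of I is determined by its products i j with j in I. Since (i p) j = i (p
  j) = i j, it follows that i p = i. In the second assertion \<pi> restricts a functional on A' to F
  and identifies the dual of F with A. It is multiplicative because F is a submodule, and an element
  of A that vanishes on F is 0 because A embeds in the dual of F. The bimodule I' consists of
  functionals on a part of the algebra, so it fits into the one type over which
  \<open>amenable\<close> quantifies.\<close>

lemma complex_ring_simps [simp]:
  "carrier complex_ring = UNIV"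
  "x \<oplus>\<^bsub>complex_ring\<^esub> y = x + y"
  "x \<otimes>\<^bsub>complex_ring\<^esub> y = x * y"
  "\<zero>\<^bsub>complex_ring\<^esub> = 0"
  "\<one>\<^bsub>complex_ring\<^esub> = 1"
  by (simp_all add: complex_ring_def)

lemma cring_complex_ring: "cring complex_ring"
proof (intro cringI abelian_groupI comm_monoidI)
  show "\<exists>y\<in>carrier complex_ring. y \<oplus>\<^bsub>complex_ring\<^esub> x = \<zero>\<^bsub>complex_ring\<^esub>" for x
    by (simp add: exI[of _ "- x"])
qed (auto simp: algebra_simps)

lemma complex_normed_spaceI:
  fixes X :: "'a normed_module" (structure)
  assumes "\<And>x y. x \<in> carrier X \<Longrightarrow> y \<in> carrier X \<Longrightarrow> x \<oplus> y \<in> carrier X"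
    and "\<zero> \<in> carrier X"
    and "\<And>x y z. x \<in> carrier X \<Longrightarrow> y \<in> carrier X \<Longrightarrow> z \<in> carrier X \<Longrightarrow> x \<oplus> y \<oplus> z = x \<oplus> (y \<oplus> z)"
    and "\<And>x y. x \<in> carrier X \<Longrightarrow> y \<in> carrier X \<Longrightarrow> x \<oplus> y = y \<oplus> x"
    and l_zero: "\<And>x. x \<in> carrier X \<Longrightarrow> \<zero> \<oplus> x = x"
    and "\<And>c x. x \<in> carrier X \<Longrightarrow> c \<odot> x \<in> carrier X"
    and "\<And>c d x. x \<in> carrier X \<Longrightarrow> (c + d) \<odot> x = c \<odot> x \<oplus> d \<odot> x"
    and "\<And>c x y. x \<in> carrier X \<Longrightarrow> y \<in> carrier X \<Longrightarrow> c \<odot> (x \<oplus> y) = c \<odot> x \<oplus> c \<odot> y"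
    and "\<And>c d x. x \<in> carrier X \<Longrightarrow> (c * d) \<odot> x = c \<odot> (d \<odot> x)"
    and "\<And>x. x \<in> carrier X \<Longrightarrow> 1 \<odot> x = x"
    and "\<And>x. x \<in> carrier X \<Longrightarrow> 0 \<odot> x = \<zero>"
    and "\<And>x. x \<in> carrier X \<Longrightarrow> 0 \<le> nrm X x"
    and "\<And>x. x \<in> carrier X \<Longrightarrow> nrm X x = 0 \<longleftrightarrow> x = \<zero>"
    and "\<And>x y. x \<in> carrier X \<Longrightarrow> y \<in> carrier X \<Longrightarrow> nrm X (x \<oplus> y) \<le> nrm X x + nrm X y"
    and "\<And>c x. x \<in> carrier X \<Longrightarrow> nrm X (c \<odot> x) = cmod c * nrm X x"
  shows "complex_normed_space X"
proof (intro complex_normed_space.intro moduleI cring_complex_ring abelian_groupI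
    complex_normed_space_axioms.intro)
  \<comment> \<open>The inverse is (-1) x: distributivity gives (-1) x + 1 x = 0 x, and 0 x is
    \<open>\<zero>\<close>.\<close>
  show "\<exists>y\<in>carrier X. y \<oplus> x = \<zero>" if "x \<in> carrier X" for x
    using that assms(6,11) assms(7)[of x "- 1" 1] assms(10)[of x] by auto
qed (use assms in \<open>simp_all\<close>)

context complex_normed_space
begin

lemma scale_closed [simp, intro]: "x \<in> carrier X \<Longrightarrow> c \<odot> x \<in> carrier X"
  using smult_closed[of c x] by simp

lemma scale_zero [simp]: "x \<in> carrier X \<Longrightarrow> 0 \<odot> x = \<zero>"
  using smult_l_null[of x] by simp

lemma scale_one [simp]: "x \<in> carrier X \<Longrightarrow> 1 \<odot> x = x"
  using smult_one[of x] by simp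

lemma scale_add_left: "x \<in> carrier X \<Longrightarrow> (c + d) \<odot> x = c \<odot> x \<oplus> d \<odot> x"
  using smult_l_distr[of c d x] by simp

lemma scale_add_right:
  "x \<in> carrier X \<Longrightarrow> y \<in> carrier X \<Longrightarrow> c \<odot> (x \<oplus> y) = c \<odot> x \<oplus> c \<odot> y"
  using smult_r_distr[of c x y] by simp

lemma scale_scale: "x \<in> carrier X \<Longrightarrow> c \<odot> (d \<odot> x) = (c * d) \<odot> x"
  using smult_assoc1[of c d x] by simp

lemma scale_zero_right [simp]: "c \<odot> \<zero> = \<zero>"
  using scale_scale[of \<zero> c 0] by simp

lemma scale_minus_one: "x \<in> carrier X \<Longrightarrow> (- 1) \<odot> x = \<ominus> x"
  using scale_add_left[of x "- 1" 1] by (intro minus_equality[symmetric]) auto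

lemma minus_add_cancel: "x \<in> carrier X \<Longrightarrow> y \<in> carrier X \<Longrightarrow> x \<ominus> y \<oplus> y = x"
  by (simp add: minus_eq a_assoc l_neg)

lemma minus_unique: "z \<in> carrier X \<Longrightarrow> y \<in> carrier X \<Longrightarrow> z \<oplus> y = x \<Longrightarrow> x \<ominus> y = z"
  by (auto simp: minus_eq a_assoc r_neg)

lemma nrm_zero [simp]: "nrm X \<zero> = 0"
  using nrm_eq_zero by blast

lemma nrm_minus_commute:
  assumes "x \<in> carrier X" "y \<in> carrier X"
  shows "nrm X (x \<ominus> y) = nrm X (y \<ominus> x)"
proof -
  have "y \<ominus> x = (- 1) \<odot> (x \<ominus> y)"
    using assms by (simp add: scale_minus_one minus_eq minus_add a_comm)
  then show ?thesis
    using assms nrm_scale[of "x \<ominus> y" "- 1"] by simp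
qed

section \<open>The norm metric and completeness\<close>

lemma Metric_space_ndist: "Metric_space (carrier X) (ndist X)"
proof
  fix x y
  show "0 \<le> ndist X x y" "ndist X x y = ndist X y x"
    using nrm_nonneg nrm_minus_commute by (auto simp: ndist_def)
  show "ndist X x y = 0 \<longleftrightarrow> x = y" if "x \<in> carrier X" "y \<in> carrier X"
    using that nrm_eq_zero[of "x \<ominus> y"] minus_add_cancel[of x y] minus_unique[of \<zero> y x]
    by (auto simp: ndist_def)
  show "ndist X x z \<le> ndist X x y + ndist X y z"
    if "x \<in> carrier X" "y \<in> carrier X" "z \<in> carrier X" for z
  proof -
    have "x \<ominus> z = (x \<ominus> y) \<oplus> (y \<ominus> z)"
      using that by (intro minus_unique) (auto simp: a_assoc minus_add_cancel)
    then show ?thesis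
      using that nrm_triangle[of "x \<ominus> y" "y \<ominus> z"] by (simp add: ndist_def)
  qed
qed

text \<open>On sequences in the carrier the default value of \<open>ndist\<close> never occurs, so
  completeness can be handled through the norm alone.\<close>

lemma mcomplete_iff:
  "Metric_space.mcomplete (carrier X) (ndist X) \<longleftrightarrow>
    (\<forall>s :: nat \<Rightarrow> 'a. range s \<subseteq> carrier X \<longrightarrow>
      (\<forall>e>0. \<exists>N. \<forall>m\<ge>N. \<forall>n\<ge>N. nrm X (s m \<ominus> s n) < e) \<longrightarrow>
      (\<exists>x\<in>carrier X. \<forall>e>0. \<exists>N. \<forall>n\<ge>N. nrm X (s n \<ominus> x) < e))"
proof -
  interpret M: Metric_space "carrier X" "ndist X"
    by (rule Metric_space_ndist)
  have Cauchy: "M.MCauchy s \<longleftrightarrow>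
      range s \<subseteq> carrier X \<and> (\<forall>e>0. \<exists>N. \<forall>m\<ge>N. \<forall>n\<ge>N. nrm X (s m \<ominus> s n) < e)" for s
    unfolding M.MCauchy_def ndist_def by (fastforce simp: image_subset_iff)
  have limit: "limitin M.mtopology s x sequentially \<longleftrightarrow>
      x \<in> carrier X \<and> (\<forall>e>0. \<exists>N. \<forall>n\<ge>N. nrm X (s n \<ominus> x) < e)"
    if "range s \<subseteq> carrier X" for s x
    using that unfolding M.limitin_metric eventually_sequentially ndist_def
    by (auto simp: image_subset_iff)
  show ?thesis
    unfolding M.mcomplete_def Cauchy using limit by (intro arg_cong[where f = All] ext) auto
qed

end

lemma banach_spaceI:
  fixes X :: "'a normed_module" (structure)
  assumes "complex_normed_space X"
    and "\<And>s :: nat \<Rightarrow> 'a. range s \<subseteq> carrier X \<Longrightarrow>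
      (\<And>e. e > 0 \<Longrightarrow> \<exists>N. \<forall>m\<ge>N. \<forall>n\<ge>N. nrm X (s m \<ominus> s n) < e) \<Longrightarrow>
      \<exists>x\<in>carrier X. \<forall>e>0. \<exists>N. \<forall>n\<ge>N. nrm X (s n \<ominus> x) < e"
  shows "banach_space X"
proof (intro banach_space.intro assms(1) banach_space_axioms.intro
    complex_normed_space.mcomplete_iff[OF assms(1), THEN iffD2] allI impI)
  fix s :: "nat \<Rightarrow> 'a"
  assume "range s \<subseteq> carrier X" "\<forall>e>0. \<exists>N. \<forall>m\<ge>N. \<forall>n\<ge>N. nrm X (s m \<ominus> s n) < e"
  then show "\<exists>x\<in>carrier X. \<forall>e>0. \<exists>N. \<forall>n\<ge>N. nrm X (s n \<ominus> x) < e"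
    using assms(2)[of s] by simp
qed

section \<open>Enough bounded functionals\<close>

text \<open>Functionals are bounded only by twice the norm, so that the complex Hahn--Banach theorem
  reduces to the real one without adjusting arguments of complex numbers.\<close>

definition (in complex_normed_space) dominated_graph :: "('a \<times> real) set \<Rightarrow> bool" where
  "dominated_graph G \<longleftrightarrow>
     (\<forall>x t. (x, t) \<in> G \<longrightarrow> x \<in> carrier X \<and> t \<le> nrm X x \<and>
       (\<forall>c. (complex_of_real c \<odot> x, c * t) \<in> G) \<and>
       (\<forall>y s. (y, s) \<in> G \<longrightarrow> (x \<oplus> y, t + s) \<in> G))"

context complex_normed_space
begin

lemma dominated_graphD:
  assumes "dominated_graph G" "(x, t) \<in> G"
  shows "x \<in> carrier X" "(complex_of_real c \<odot> x, c * t) \<in> G" "t \<le> nrm X x"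
    "(y, s) \<in> G \<Longrightarrow> (x \<oplus> y, t + s) \<in> G"
  using assms unfolding dominated_graph_def by blast+

lemma dominated_graphI:
  assumes "\<And>x t. (x, t) \<in> G \<Longrightarrow> x \<in> carrier X"
    and "\<And>x t c. (x, t) \<in> G \<Longrightarrow> (complex_of_real c \<odot> x, c * t) \<in> G"
    and "\<And>x t. (x, t) \<in> G \<Longrightarrow> t \<le> nrm X x"
    and "\<And>x t y s. (x, t) \<in> G \<Longrightarrow> (y, s) \<in> G \<Longrightarrow> (x \<oplus> y, t + s) \<in> G"
  shows "dominated_graph G"
  unfolding dominated_graph_def by (intro allI impI conjI) (fact assms)+

lemma dominated_graph_abs:
  assumes "dominated_graph G" "(x, t) \<in> G"
  shows "\<bar>t\<bar> \<le> nrm X x"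
  using dominated_graphD(3)[OF assms] dominated_graphD(1)[OF assms] nrm_scale[of x "- 1"]
    dominated_graphD(3)[OF assms(1) dominated_graphD(2)[OF assms, of "- 1"]]
  by simp

text \<open>Domination by the norm forces single-valuedness: the difference of two values at x is a
  value at \<open>\<zero>\<close>, hence of absolute value at most 0. With functionals as sets of
  pairs, extension is inclusion and the union of a chain is its upper bound, as Zorn's lemma
  wants.\<close>

lemma dominated_graph_unique:
  assumes G: "dominated_graph G" and "(x, t) \<in> G" "(x, s) \<in> G"
  shows "t = s"
proof -
  have x: "x \<in> carrier X"
    by (rule dominated_graphD) fact+
  have "((- 1) \<odot> x \<oplus> x, - t + s) \<in> G"
    using dominated_graphD(4)[OF G dominated_graphD(2)[OF G assms(2), of "- 1"] assms(3)] by simp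
  then have "(\<zero>, - t + s) \<in> G"
    using x by (simp add: scale_minus_one l_neg)
  from dominated_graph_abs[OF G this] show ?thesis
    by simp
qed

text \<open>The one-step extension in the Hahn--Banach theorem. A value c at z is admissible if it
  lies above all t - |x - z| and below all |y + z| - s, for (x, t) and (y, s) in the graph. By the
  triangle inequality every lower bound is below every upper bound, so the supremum of the lower
  bounds will do.\<close>

lemma dominated_graph_extend:
  assumes G: "dominated_graph G" and "G \<noteq> {}" and z: "z \<in> carrier X"
  shows "\<exists>G' c. dominated_graph G' \<and> G \<subseteq> G' \<and> (z, c) \<in> G'"
proof -
  define c where "c = (SUP (x, t)\<in>G. t - nrm X (x \<oplus> (- 1) \<odot> z))"
  note D = dominated_graphD[OF G]
  have key: "t - nrm X (x \<oplus> (- 1) \<odot> z) \<le> nrm X (y \<oplus> z) - s"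
    if "(x, t) \<in> G" "(y, s) \<in> G" for x t y s
  proof -
    have xy: "x \<in> carrier X" "y \<in> carrier X"
      using that D(1) by blast+
    have "(x \<oplus> (- 1) \<odot> z) \<oplus> (y \<oplus> z) = (x \<oplus> y) \<oplus> ((- 1) \<odot> z \<oplus> z)"
      using xy z by (simp only: a_ac a_closed scale_closed)
    also have "\<dots> = x \<oplus> y"
      using xy z by (simp add: scale_minus_one l_neg)
    finally have "x \<oplus> y = (x \<oplus> (- 1) \<odot> z) \<oplus> (y \<oplus> z)" ..
    then have "nrm X (x \<oplus> y) \<le> nrm X (x \<oplus> (- 1) \<odot> z) + nrm X (y \<oplus> z)"
      using nrm_triangle xy z by simp
    then show ?thesis
      using D(3)[OF D(4)[OF that]] by simp
  qed
  obtain x1 t1 where G1: "(x1, t1) \<in> G"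
    using \<open>G \<noteq> {}\<close> by auto
  have bdd: "bdd_above ((\<lambda>(x, t). t - nrm X (x \<oplus> (- 1) \<odot> z)) ` G)"
    using key[OF _ G1] by (intro bdd_aboveI[of _ "nrm X (x1 \<oplus> z) - t1"]) auto
  have lower: "t - nrm X (x \<oplus> (- 1) \<odot> z) \<le> c" if "(x, t) \<in> G" for x t
    unfolding c_def using cSUP_upper[OF that bdd] by simp
  have upper: "c \<le> nrm X (x \<oplus> z) - t" if "(x, t) \<in> G" for x t
    unfolding c_def using key that \<open>G \<noteq> {}\<close> by (intro cSUP_least) auto
  \<comment> \<open>For nonzero s, division by its absolute value leaves the cases s = 1 and s = -1,
    which are \<open>upper\<close> and \<open>lower\<close>.\<close>
  have dom: "t + s * c \<le> nrm X (x \<oplus> of_real s \<odot> z)" if xt: "(x, t) \<in> G" for x t s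
  proof -
    have x: "x \<in> carrier X"
      by (rule D(1)) fact
    consider "s = 0" | "s > 0" | "s < 0"
      by linarith
    then show ?thesis
    proof cases
      case 1
      then show ?thesis
        using D(3)[OF xt] x z by simp
    next
      case 2
      have "of_real s \<odot> (of_real (1 / s) \<odot> x \<oplus> z) = x \<oplus> of_real s \<odot> z"
        using 2 x z by (simp add: scale_add_right scale_scale)
      then have "nrm X (x \<oplus> of_real s \<odot> z) = s * nrm X (of_real (1 / s) \<odot> x \<oplus> z)"
        using 2 x z nrm_scale[of "of_real (1 / s) \<odot> x \<oplus> z" "of_real s"] by simp
      moreover have "s * c \<le> s * (nrm X (of_real (1 / s) \<odot> x \<oplus> z) - 1 / s * t)"
        using 2 by (intro mult_left_mono upper D(2) xt) simp
      ultimately show ?thesis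
        using 2 by (simp add: right_diff_distrib)
    next
      case 3
      have "of_real (- s) \<odot> (of_real (1 / (- s)) \<odot> x \<oplus> (- 1) \<odot> z) = x \<oplus> of_real s \<odot> z"
        using 3 x z by (simp only: scale_add_right scale_closed scale_scale) simp
      then have "nrm X (x \<oplus> of_real s \<odot> z) = (- s) * nrm X (of_real (1 / (- s)) \<odot> x \<oplus> (- 1) \<odot> z)"
        using 3 x z nrm_scale[of "of_real (1 / (- s)) \<odot> x \<oplus> (- 1) \<odot> z" "of_real (- s)"] by simp
      moreover have "(- s) * (1 / (- s) * t - nrm X (of_real (1 / (- s)) \<odot> x \<oplus> (- 1) \<odot> z)) \<le> (- s) * c"
        using 3 by (intro mult_left_mono lower D(2) xt) simp
      moreover have "(- s) * (1 / (- s) * t) = t"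
        using 3 by simp
      ultimately show ?thesis
        unfolding right_diff_distrib by linarith
    qed
  qed
  define G' where "G' = {(x \<oplus> of_real s \<odot> z, t + s * c) | x t s. (x, t) \<in> G}"
  have in_G': "(x \<oplus> of_real s \<odot> z, t + s * c) \<in> G'" if "(x, t) \<in> G" for x t s
    unfolding G'_def using that by blast
  have "dominated_graph G'"
  proof (rule dominated_graphI)
    fix y u assume "(y, u) \<in> G'"
    then obtain x t s where xt: "(x, t) \<in> G" and yu: "y = x \<oplus> of_real s \<odot> z" "u = t + s * c"
      unfolding G'_def by auto
    have x: "x \<in> carrier X"
      by (rule D(1)) fact
    show "y \<in> carrier X"
      using x z yu by simp
    show "u \<le> nrm X y"
      using dom[OF xt] yu by simp
    show "(of_real d \<odot> y, d * u) \<in> G'" for d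
      using in_G'[OF D(2)[OF xt, of d], of "d * s"] yu x z
      by (simp add: scale_add_right scale_scale algebra_simps)
    fix y' u' assume "(y', u') \<in> G'"
    then obtain x' t' s' where xt': "(x', t') \<in> G" and yu': "y' = x' \<oplus> of_real s' \<odot> z" "u' = t' + s' * c"
      unfolding G'_def by auto
    have x': "x' \<in> carrier X"
      by (rule D(1)) fact
    have "(x \<oplus> x') \<oplus> of_real (s + s') \<odot> z = y \<oplus> y'"
      using x x' z yu yu' by (simp add: scale_add_left a_ac)
    moreover have "(t + t') + (s + s') * c = u + u'"
      using yu yu' by (simp add: algebra_simps)
    ultimately show "(y \<oplus> y', u + u') \<in> G'"
      using in_G'[OF D(4)[OF xt xt'], of "s + s'"] by simp
  qed
  moreover have "G \<subseteq> G'"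
  proof clarify
    fix x t assume "(x, t) \<in> G"
    then show "(x, t) \<in> G'"
      using in_G'[of x t 0] D(1)[of x t] z by simp
  qed
  moreover have "(z, c) \<in> G'"
    using in_G'[OF D(2)[OF G1, of 0], of 1] D(1)[OF G1] z by simp
  ultimately show ?thesis
    by blast
qed

text \<open>Zorn's lemma, starting from the line spanned by \<open>a\<close>: a maximal graph
  reaches every vector, because otherwise \<open>dominated_graph_extend\<close> would enlarge
  it.\<close>

lemma dominated_graph_total:
  assumes "a \<in> carrier X"
  shows "\<exists>G. dominated_graph G \<and> (a, nrm X a) \<in> G \<and> (\<forall>x\<in>carrier X. \<exists>t. (x, t) \<in> G)"
proof -
  define H where "H = {G. dominated_graph G \<and> (a, nrm X a) \<in> G}"
  define G0 where "G0 = range (\<lambda>s. (complex_of_real s \<odot> a, s * nrm X a))"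
  have in_G0: "(of_real s \<odot> a, s * nrm X a) \<in> G0" for s
    unfolding G0_def by blast
  have "dominated_graph G0"
  proof (rule dominated_graphI)
    fix x t assume "(x, t) \<in> G0"
    then obtain s where xt: "x = of_real s \<odot> a" "t = s * nrm X a"
      unfolding G0_def by blast
    show "x \<in> carrier X"
      using assms xt by simp
    show "t \<le> nrm X x"
      using assms xt by (simp add: nrm_scale nrm_nonneg mult_right_mono)
    show "(of_real c \<odot> x, c * t) \<in> G0" for c
      using assms xt in_G0[of "c * s"] by (simp add: scale_scale mult.assoc)
    fix y t' assume "(y, t') \<in> G0"
    then obtain s' where yt: "y = of_real s' \<odot> a" "t' = s' * nrm X a"
      unfolding G0_def by blast
    show "(x \<oplus> y, t + t') \<in> G0"
      using assms xt yt in_G0[of "s + s'"] by (simp add: scale_add_left distrib_right)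
  qed
  then have "G0 \<in> H"
    using in_G0[of 1] assms by (simp add: H_def)
  then have "H \<noteq> {}"
    by blast
  moreover have "\<Union>\<C> \<in> H" if "\<C> \<noteq> {}" and chain: "subset.chain H \<C>" for \<C>
  proof -
    have sub: "dominated_graph G" "(a, nrm X a) \<in> G" if "G \<in> \<C>" for G
      using that chain unfolding subset.chain_def H_def by blast+
    have common: "\<exists>G\<in>\<C>. p \<in> G \<and> q \<in> G" if "p \<in> \<Union>\<C>" "q \<in> \<Union>\<C>" for p q
      using that chain unfolding subset_chain_def by blast
    have "dominated_graph (\<Union>\<C>)"
    proof (rule dominated_graphI)
      fix x t assume "(x, t) \<in> \<Union>\<C>"
      then obtain G where xt: "(x, t) \<in> G" "G \<in> \<C>"
        by blast
      note D = dominated_graphD[OF sub(1)]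
      show "x \<in> carrier X" "t \<le> nrm X x" "(of_real c \<odot> x, c * t) \<in> \<Union>\<C>" for c
        using D[OF xt(2,1)] xt(2) by blast+
      fix y s assume "(y, s) \<in> \<Union>\<C>"
      then obtain G' where "G' \<in> \<C>" "(x, t) \<in> G'" "(y, s) \<in> G'"
        using common[of "(x, t)" "(y, s)"] xt by blast
      then show "(x \<oplus> y, t + s) \<in> \<Union>\<C>"
        using D(4)[of G' x t y s] by blast
    qed
    then show ?thesis
      using sub(2) \<open>\<C> \<noteq> {}\<close> unfolding H_def by blast
  qed
  ultimately obtain G where "G \<in> H" and max: "\<forall>G'\<in>H. G \<subseteq> G' \<longrightarrow> G' = G"
    using subset_Zorn_nonempty[of H] by blast
  then have G: "dominated_graph G" "(a, nrm X a) \<in> G"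
    by (simp_all add: H_def)
  have "\<exists>t. (x, t) \<in> G" if x: "x \<in> carrier X" for x
  proof -
    obtain G' c where G': "dominated_graph G'" "G \<subseteq> G'" "(x, c) \<in> G'"
      using dominated_graph_extend[OF G(1) _ x] G(2) by blast
    then have "G' = G"
      using max G(2) by (auto simp: H_def)
    then show ?thesis
      using G'(3) by blast
  qed
  then show ?thesis
    using G by blast
qed

theorem dual_separates:
  assumes a: "a \<in> carrier X" and "a \<noteq> \<zero>"
  shows "\<exists>f\<in>carrier (dual X). f a \<noteq> 0"
proof -
  obtain G where G: "dominated_graph G" and Ga: "(a, nrm X a) \<in> G"
    and total: "\<And>x. x \<in> carrier X \<Longrightarrow> \<exists>t. (x, t) \<in> G"
    using dominated_graph_total[OF a] by blast
  define u where "u x = (SOME t. (x, t) \<in> G)" for x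
  have uG: "(x, u x) \<in> G" if "x \<in> carrier X" for x
    unfolding u_def by (rule someI_ex[OF total[OF that]])
  have u_eq: "u x = t" if "(x, t) \<in> G" for x t
    using dominated_graph_unique[OF G uG that] dominated_graphD(1)[OF G that] by blast
  have u_add: "u (x \<oplus> y) = u x + u y" if "x \<in> carrier X" "y \<in> carrier X" for x y
    by (intro u_eq dominated_graphD(4)[OF G] uG that)
  have u_scale: "u (of_real c \<odot> x) = c * u x" if "x \<in> carrier X" for x c
    by (intro u_eq dominated_graphD(2)[OF G] uG that)
  have u_abs: "\<bar>u x\<bar> \<le> nrm X x" if "x \<in> carrier X" for x
    using dominated_graph_abs[OF G uG[OF that]] .
  \<comment> \<open>A complex-linear functional with real part u can only be u(x) - i u(i x). At
    \<open>a\<close> its real part is the norm of \<open>a\<close>.\<close>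
  define f where "f = (\<lambda>x\<in>carrier X. Complex (u x) (- u (\<i> \<odot> x)))"
  have "f \<in> dual_carrier X"
    unfolding dual_carrier_def
  proof (intro CollectI conjI ballI allI exI[of _ 2])
    show "f \<in> extensional (carrier X)"
      by (simp add: f_def)
    show "f (x \<oplus> y) = f x + f y" if "x \<in> carrier X" "y \<in> carrier X" for x y
      using that by (simp add: f_def u_add scale_add_right complex_eq_iff)
    show "f (c \<odot> x) = c * f x" if x: "x \<in> carrier X" for c x
    proof -
      have 1: "u (c \<odot> x) = Re c * u x + Im c * u (\<i> \<odot> x)" for c
      proof -
        have "c \<odot> x = (of_real (Re c) + of_real (Im c) * \<i>) \<odot> x"
          by (rule arg_cong[where f = "\<lambda>c. c \<odot> x"]) (simp add: complex_eq_iff)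
        also have "\<dots> = of_real (Re c) \<odot> x \<oplus> of_real (Im c) \<odot> (\<i> \<odot> x)"
          using x by (simp only: scale_add_left scale_scale)
        finally show ?thesis
          using x u_scale[of x "Re c"] u_scale[of "\<i> \<odot> x" "Im c"] by (simp add: u_add)
      qed
      have "f (c \<odot> x) = Complex (u (c \<odot> x)) (- u ((\<i> * c) \<odot> x))"
        using x by (simp add: f_def scale_scale)
      also have "\<dots> = c * f x"
        using x by (simp add: f_def complex_eq_iff 1[of c] 1[of "\<i> * c"])
      finally show ?thesis .
    qed
    show "cmod (f x) \<le> 2 * nrm X x" if "x \<in> carrier X" for x
    proof -
      have "cmod (f x) \<le> \<bar>Re (f x)\<bar> + \<bar>Im (f x)\<bar>"
        by (rule cmod_le)
      also have "\<dots> = \<bar>u x\<bar> + \<bar>u (\<i> \<odot> x)\<bar>"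
        using that by (simp add: f_def)
      also have "\<dots> \<le> nrm X x + nrm X (\<i> \<odot> x)"
        using that by (intro add_mono u_abs) auto
      finally show ?thesis
        using nrm_scale[OF that, of \<i>] by simp
    qed
  qed
  moreover have "Re (f a) \<noteq> 0"
    using assms u_eq[OF Ga] nrm_eq_zero[OF a] by (simp add: f_def)
  then have "f a \<noteq> 0"
    by force
  ultimately show ?thesis
    by (auto simp: dual_def)
qed

end

section \<open>Duals and annihilators\<close>

lemma dual_simps [simp]:
  "carrier (dual X) = dual_carrier X"
  "\<zero>\<^bsub>dual X\<^esub> = (\<lambda>x\<in>carrier X. 0)"
  "f \<oplus>\<^bsub>dual X\<^esub> g = (\<lambda>x\<in>carrier X. f x + g x)"
  "c \<odot>\<^bsub>dual X\<^esub> f = (\<lambda>x\<in>carrier X. c * f x)"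
  by (simp_all add: dual_def)

lemma dual_carrierI:
  assumes "f \<in> extensional (carrier X)"
    and "\<And>x y. x \<in> carrier X \<Longrightarrow> y \<in> carrier X \<Longrightarrow> f (x \<oplus>\<^bsub>X\<^esub> y) = f x + f y"
    and "\<And>c x. x \<in> carrier X \<Longrightarrow> f (c \<odot>\<^bsub>X\<^esub> x) = c * f x"
    and "\<And>x. x \<in> carrier X \<Longrightarrow> cmod (f x) \<le> K * nrm X x"
  shows "f \<in> dual_carrier X"
  using assms unfolding dual_carrier_def by blast

lemma dual_carrierD:
  assumes "f \<in> dual_carrier X"
  shows "f \<in> extensional (carrier X)"
    and "x \<in> carrier X \<Longrightarrow> y \<in> carrier X \<Longrightarrow> f (x \<oplus>\<^bsub>X\<^esub> y) = f x + f y"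
    and "x \<in> carrier X \<Longrightarrow> f (c \<odot>\<^bsub>X\<^esub> x) = c * f x"
  using assms unfolding dual_carrier_def by blast+

lemma dual_eqI:
  assumes "f \<in> extensional (carrier X)" "g \<in> extensional (carrier X)"
    "\<And>x. x \<in> carrier X \<Longrightarrow> f x = g x"
  shows "f = g"
  using assms by (rule extensionalityI)

context complex_normed_space
begin

lemma dual_zero: "f \<in> dual_carrier X \<Longrightarrow> f \<zero> = 0"
  using dual_carrierD(3)[of f X \<zero> 0] by simp

text \<open>The supremum in \<open>dual\<close> is meaningful only for a set that is bounded above.
  The constant K in \<open>dual_carrier\<close> may be negative, hence its absolute value.\<close>

lemma dual_bdd_above:
  assumes "f \<in> dual_carrier X"
  shows "bdd_above ((\<lambda>x. cmod (f x)) ` {x \<in> carrier X. nrm X x \<le> 1})"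
proof -
  obtain K where K: "\<And>x. x \<in> carrier X \<Longrightarrow> cmod (f x) \<le> K * nrm X x"
    using assms unfolding dual_carrier_def by blast
  have "cmod (f x) \<le> \<bar>K\<bar>" if "x \<in> carrier X" "nrm X x \<le> 1" for x
  proof -
    have "cmod (f x) \<le> \<bar>K\<bar> * nrm X x"
      using K[OF that(1)] mult_right_mono[OF abs_ge_self nrm_nonneg[OF that(1)], of K] by linarith
    also have "\<dots> \<le> \<bar>K\<bar> * 1"
      using that by (intro mult_left_mono) auto
    finally show ?thesis
      by simp
  qed
  then show ?thesis
    by (intro bdd_aboveI[of _ "\<bar>K\<bar>"]) auto
qed

lemma dual_bound:
  assumes f: "f \<in> dual_carrier X" and x: "x \<in> carrier X"
  shows "cmod (f x) \<le> nrm (dual X) f * nrm X x"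
proof (cases "x = \<zero>")
  case True
  then show ?thesis
    using f dual_zero by simp
next
  case False
  then have pos: "nrm X x > 0"
    using x nrm_nonneg nrm_eq_zero by (metis less_eq_real_def)
  let ?y = "complex_of_real (1 / nrm X x) \<odot> x"
  have "cmod (f ?y) \<le> nrm (dual X) f"
    using x pos unfolding dual_def
    by (simp, intro cSUP_upper dual_bdd_above[OF f]) (simp add: nrm_scale norm_divide)
  then have "cmod (f x) / nrm X x \<le> nrm (dual X) f"
    using pos f x by (simp add: dual_carrierD(3) norm_divide)
  then show ?thesis
    using pos by (simp add: pos_divide_le_eq)
qed

lemma dual_nrm_nonneg: "f \<in> dual_carrier X \<Longrightarrow> 0 \<le> nrm (dual X) f"
  unfolding dual_def
  by (simp, rule order_trans[OF _ cSUP_upper[of \<zero>, OF _ dual_bdd_above]]) auto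

lemma dual_nrm_le:
  assumes "0 \<le> K" "\<And>x. x \<in> carrier X \<Longrightarrow> cmod (f x) \<le> K * nrm X x"
  shows "nrm (dual X) f \<le> K"
proof -
  have "cmod (f x) \<le> K" if "x \<in> carrier X" "nrm X x \<le> 1" for x
    using assms(2)[OF that(1)] mult_left_mono[OF that(2) assms(1)] by simp
  moreover have "\<zero> \<in> {x \<in> carrier X. nrm X x \<le> 1}"
    by simp
  ultimately show ?thesis
    unfolding dual_def by (simp, intro cSUP_least) auto
qed

end

text \<open>One locale for three spaces: the dual of a space and the second dual of an algebra, both
  with \<open>S\<close> empty, and the ideal of the second dual that annihilates a set
  \<open>F\<close> of functionals. Only the linear structure and the norm of \<open>Y\<close> are
  prescribed, so that \<open>mult\<close> is free to be the Arens product.\<close>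

locale annihilator_space = X: complex_normed_space X for X :: "'a normed_module" +
  fixes S :: "'a set" and Y :: "('a \<Rightarrow> complex) normed_module" (structure)
  assumes S_subset: "S \<subseteq> carrier X"
    and carrier_Y [simp]: "carrier Y = {f \<in> dual_carrier X. \<forall>x\<in>S. f x = 0}"
    and zero_Y [simp]: "\<zero> = (\<lambda>x\<in>carrier X. 0)"
    and add_Y [simp]: "f \<oplus> g = (\<lambda>x\<in>carrier X. f x + g x)"
    and smult_Y [simp]: "c \<odot> f = (\<lambda>x\<in>carrier X. c * f x)"
    and nrm_Y [simp]: "nrm Y f = nrm (dual X) f"
begin

lemma normed_space: "complex_normed_space Y"
proof (rule complex_normed_spaceI)
  fix f g h :: "'a \<Rightarrow> complex" and c d :: complex
  assume "f \<in> carrier Y"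
  then have f: "f \<in> dual_carrier X" and fS: "\<And>x. x \<in> S \<Longrightarrow> f x = 0"
    by auto
  note f1 = dual_carrierD(1)[OF f]
  note bound = X.dual_bound
  show "0 \<le> nrm Y f"
    using X.dual_nrm_nonneg[OF f] by simp
  show "\<zero> \<oplus> f = f" "1 \<odot> f = f" "0 \<odot> f = \<zero>"
    by (auto intro!: dual_eqI[of _ X] f1)
  show "(c + d) \<odot> f = c \<odot> f \<oplus> d \<odot> f" "(c * d) \<odot> f = c \<odot> (d \<odot> f)"
    by (auto simp: algebra_simps)
  have cf: "cmod (c * f x) \<le> cmod c * nrm (dual X) f * nrm X x" if "x \<in> carrier X" for x c
    using mult_left_mono[OF bound[OF f that], of "cmod c"] by (simp add: norm_mult mult.assoc)
  show cfY: "c \<odot> f \<in> carrier Y" for c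
    using f fS S_subset cf
    by (auto intro!: dual_carrierI[where K = "cmod c * nrm (dual X) f"]
        simp: dual_carrierD algebra_simps)
  show "nrm Y f = 0 \<longleftrightarrow> f = \<zero>"
  proof
    assume "nrm Y f = 0"
    then show "f = \<zero>"
      using bound[OF f] by (auto intro!: dual_eqI[of _ X] f1)
  next
    assume "f = \<zero>"
    then show "nrm Y f = 0"
      using X.dual_nrm_le[of 0 f] X.dual_nrm_nonneg[OF f] by auto
  qed
  have le: "nrm Y (c \<odot> f) \<le> cmod c * nrm Y f" for c
    using cf X.dual_nrm_nonneg[OF f] by (auto intro!: X.dual_nrm_le)
  show "nrm Y (c \<odot> f) = cmod c * nrm Y f"
  proof (cases "c = 0")
    case True
    then show ?thesis
      using le[of 0] X.dual_nrm_nonneg[of "c \<odot> f"] cfY[of c] by auto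
  next
    case False
    have "cmod (f x) \<le> (nrm Y (c \<odot> f) / cmod c) * nrm X x" if "x \<in> carrier X" for x
      using False bound[of "c \<odot> f" x] cfY[of c] that by (simp add: field_simps norm_mult)
    then have "nrm Y f \<le> nrm Y (c \<odot> f) / cmod c"
      using X.dual_nrm_nonneg[of "c \<odot> f"] cfY[of c] by (simp, intro X.dual_nrm_le) auto
    then show ?thesis
      using le[of c] False by (simp add: field_simps)
  qed
  assume "g \<in> carrier Y"
  then have g: "g \<in> dual_carrier X" and gS: "\<And>x. x \<in> S \<Longrightarrow> g x = 0"
    by auto
  have fg: "cmod (f x + g x) \<le> (nrm (dual X) f + nrm (dual X) g) * nrm X x"
    if "x \<in> carrier X" for x
    using norm_triangle_ineq[of "f x" "g x"] bound[OF f that] bound[OF g that]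
    by (simp add: distrib_right)
  show "f \<oplus> g \<in> carrier Y"
    using f g fS gS S_subset fg
    by (auto intro!: dual_carrierI[where K = "nrm (dual X) f + nrm (dual X) g"]
        simp: dual_carrierD algebra_simps)
  show "nrm Y (f \<oplus> g) \<le> nrm Y f + nrm Y g"
    using fg X.dual_nrm_nonneg f g by (auto intro!: X.dual_nrm_le)
  show "f \<oplus> g = g \<oplus> f" "c \<odot> (f \<oplus> g) = c \<odot> f \<oplus> c \<odot> g"
    by (auto simp: algebra_simps)
  show "f \<oplus> g \<oplus> h = f \<oplus> (g \<oplus> h)"
    by (auto simp: algebra_simps)
next
  show "\<zero> \<in> carrier Y"
    using S_subset by (auto intro!: dual_carrierI[where K = 0])
qed

interpretation Y: complex_normed_space Y
  by (rule normed_space)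

text \<open>Subtraction in \<open>Y\<close> goes through an abstract additive inverse and has no
  formula of its own; its values are read off from f = (f - g) + g.\<close>

lemma minus_apply:
  assumes "f \<in> carrier Y" "g \<in> carrier Y" "x \<in> carrier X"
  shows "(f \<ominus> g) x = f x - g x"
proof -
  have "f x = (f \<ominus> g \<oplus> g) x"
    using Y.minus_add_cancel[OF assms(1,2)] by presburger
  then show ?thesis
    using assms(3) by simp
qed

text \<open>A Cauchy sequence converges pointwise, uniformly relative to \<open>nrm X x\<close>. The
  pointwise limit is therefore bounded and a limit in norm, and vanishing on \<open>S\<close> passes
  to it.\<close>

lemma banach: "banach_space Y"
proof (rule banach_spaceI[OF normed_space])
  fix s :: "nat \<Rightarrow> 'a \<Rightarrow> complex"
  assume "range s \<subseteq> carrier Y"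
    and Cauchy: "\<And>e. e > 0 \<Longrightarrow> \<exists>N. \<forall>m\<ge>N. \<forall>n\<ge>N. nrm Y (s m \<ominus> s n) < e"
  then have sY: "s n \<in> carrier Y" for n
    by blast
  then have s: "s n \<in> dual_carrier X" and sS: "\<And>x. x \<in> S \<Longrightarrow> s n x = 0" for n
    by auto
  have diff: "cmod (s m x - s n x) \<le> nrm Y (s m \<ominus> s n) * nrm X x" if "x \<in> carrier X" for m n x
    using X.dual_bound[of "s m \<ominus> s n" x] Y.minus_closed[OF sY[of m] sY[of n]] that
    by (simp add: minus_apply[OF sY sY])
  have conv: "convergent (\<lambda>n. s n x)" if x: "x \<in> carrier X" for x
    unfolding Cauchy_convergent_iff[symmetric]
  proof (rule metric_CauchyI)
    fix e :: real assume "e > 0"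
    \<comment> \<open>The summand 1 keeps the denominator positive at \<open>\<zero>\<close> and
      makes the final estimate strict.\<close>
    then have "e / (nrm X x + 1) > 0"
      using X.nrm_nonneg[OF x] by simp
    from Cauchy[OF this] obtain N
      where N: "\<And>m n. m \<ge> N \<Longrightarrow> n \<ge> N \<Longrightarrow> nrm Y (s m \<ominus> s n) < e / (nrm X x + 1)"
      by blast
    have "dist (s m x) (s n x) < e" if "m \<ge> N" "n \<ge> N" for m n
    proof -
      have "dist (s m x) (s n x) \<le> e / (nrm X x + 1) * nrm X x"
        using diff[OF x, of m n] mult_right_mono[OF less_imp_le[OF N[OF that]] X.nrm_nonneg[OF x]]
        by (simp add: dist_norm)
      also have "\<dots> < e"
        using X.nrm_nonneg[OF x] \<open>e > 0\<close> by (simp add: field_simps)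
      finally show ?thesis .
    qed
    then show "\<exists>N. \<forall>m\<ge>N. \<forall>n\<ge>N. dist (s m x) (s n x) < e"
      by blast
  qed
  define f where "f = (\<lambda>x\<in>carrier X. lim (\<lambda>n. s n x))"
  have lim: "(\<lambda>n. s n x) \<longlonglongrightarrow> f x" if "x \<in> carrier X" for x
    using conv[OF that] that by (simp add: f_def convergent_LIMSEQ_iff)
  \<comment> \<open>Let m tend to infinity in \<open>diff\<close>; the index N does not depend on
    x.\<close>
  have close: "\<exists>N. \<forall>n\<ge>N. \<forall>x\<in>carrier X. cmod (s n x - f x) \<le> e * nrm X x" if e: "e > 0" for e
  proof -
    obtain N where N: "\<And>m n. m \<ge> N \<Longrightarrow> n \<ge> N \<Longrightarrow> nrm Y (s m \<ominus> s n) < e"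
      using Cauchy[OF e] by blast
    have "cmod (s n x - f x) \<le> e * nrm X x" if "n \<ge> N" and x: "x \<in> carrier X" for n x
    proof (rule LIMSEQ_le_const2)
      show "(\<lambda>m. cmod (s n x - s m x)) \<longlonglongrightarrow> cmod (s n x - f x)"
        by (intro tendsto_intros lim x)
      show "\<exists>N. \<forall>m\<ge>N. cmod (s n x - s m x) \<le> e * nrm X x"
        using diff[OF x, of n] mult_right_mono[OF less_imp_le[OF N] X.nrm_nonneg[OF x]] that(1)
        by (meson order_trans)
    qed
    then show ?thesis
      by blast
  qed
  obtain N where N: "\<And>x. x \<in> carrier X \<Longrightarrow> cmod (s N x - f x) \<le> 1 * nrm X x"
    using close[of 1] by fastforce
  have "f \<in> dual_carrier X"
  proof (rule dual_carrierI)
    show "f \<in> extensional (carrier X)"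
      by (simp add: f_def)
    show "f (x \<oplus>\<^bsub>X\<^esub> y) = f x + f y" if "x \<in> carrier X" "y \<in> carrier X" for x y
      using tendsto_add[OF lim lim, OF that] lim[of "x \<oplus>\<^bsub>X\<^esub> y"] that
      by (simp add: dual_carrierD(2)[OF s] LIMSEQ_unique)
    show "f (c \<odot>\<^bsub>X\<^esub> x) = c * f x" if "x \<in> carrier X" for c x
      using tendsto_mult_left[OF lim[OF that], of c] lim[of "c \<odot>\<^bsub>X\<^esub> x"] that
      by (simp add: dual_carrierD(3)[OF s] LIMSEQ_unique)
    show "cmod (f x) \<le> (nrm (dual X) (s N) + 1) * nrm X x" if "x \<in> carrier X" for x
      using N[OF that] X.dual_bound[OF s that, of N] norm_triangle_ineq4[of "s N x" "s N x - f x"]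
      by (simp add: distrib_right)
  qed
  moreover have "f x = 0" if "x \<in> S" for x
    using lim[of x] S_subset that by (auto simp: sS LIMSEQ_const_iff)
  ultimately have f: "f \<in> carrier Y"
    by simp
  have "\<exists>N. \<forall>n\<ge>N. nrm Y (s n \<ominus> f) < e" if "e > 0" for e
  proof -
    obtain N where N: "\<And>n x. n \<ge> N \<Longrightarrow> x \<in> carrier X \<Longrightarrow> cmod (s n x - f x) \<le> e / 2 * nrm X x"
      using close[of "e / 2"] \<open>e > 0\<close> by fastforce
    have "nrm Y (s n \<ominus> f) \<le> e / 2" if "n \<ge> N" for n
      using N[OF that] \<open>e > 0\<close>
      unfolding nrm_Y by (intro X.dual_nrm_le) (simp_all add: minus_apply[OF sY f])
    then have "nrm Y (s n \<ominus> f) < e" if "n \<ge> N" for n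
      using that \<open>e > 0\<close> by fastforce
    then show ?thesis
      by blast
  qed
  then show "\<exists>f\<in>carrier Y. \<forall>e>0. \<exists>N. \<forall>n\<ge>N. nrm Y (s n \<ominus> f) < e"
    using f by blast
qed

end

context complex_normed_space
begin

lemma annihilator_dual: "annihilator_space X {} (dual X)"
  by unfold_locales simp_all

lemma banach_dual: "banach_space (dual X)"
  by (rule annihilator_space.banach[OF annihilator_dual])

lemma dual_minus_apply:
  "f \<in> dual_carrier X \<Longrightarrow> g \<in> dual_carrier X \<Longrightarrow> x \<in> carrier X \<Longrightarrow>
    (f \<ominus>\<^bsub>dual X\<^esub> g) x = f x - g x"
  using annihilator_space.minus_apply[OF annihilator_dual] by simp

end

section \<open>Bimodules\<close>

text \<open>The constants in the axioms of a bimodule may be negative. Their absolute values serve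
  as well and have the sign that \<open>dual_nrm_le\<close> asks for.\<close>

lemma bounded_actionI:
  assumes "complex_normed_space A" "complex_normed_space X"
    and "\<exists>K. \<forall>a\<in>carrier A. \<forall>x\<in>carrier X. q a x \<le> K * nrm A a * nrm X x"
  obtains K where "K \<ge> 0"
    and "\<And>a x. a \<in> carrier A \<Longrightarrow> x \<in> carrier X \<Longrightarrow> q a x \<le> K * nrm A a * nrm X x"
proof -
  obtain K where K: "\<And>a x. a \<in> carrier A \<Longrightarrow> x \<in> carrier X \<Longrightarrow> q a x \<le> K * nrm A a * nrm X x"
    using assms(3) by blast
  have "q a x \<le> \<bar>K\<bar> * nrm A a * nrm X x" if "a \<in> carrier A" "x \<in> carrier X" for a x
  proof -
    have "K * (nrm A a * nrm X x) \<le> \<bar>K\<bar> * (nrm A a * nrm X x)"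
      using that assms(1,2)[THEN complex_normed_space.nrm_nonneg] by (intro mult_right_mono) auto
    then show ?thesis
      using K[OF that] by (simp add: mult.assoc)
  qed
  then show thesis
    using that[of "\<bar>K\<bar>"] by simp
qed

text \<open>Amenability will be applied to a bimodule that is itself a dual, namely that of an
  ideal; this makes it a Banach bimodule.\<close>

lemma dual_banach_bimodule:
  fixes A :: "'a normed_module" and X :: "'b normed_module"
  assumes A: "complex_normed_space A" and "banach_bimodule A X l r"
  shows "banach_bimodule A (dual X) (dual_left X r) (dual_right X l)"
proof -
  interpret A: complex_normed_space A
    by fact
  interpret B: banach_bimodule A X l r
    by fact
  obtain K where K: "K \<ge> 0"
    "\<And>a x. a \<in> carrier A \<Longrightarrow> x \<in> carrier X \<Longrightarrow> nrm X (l a x) \<le> K * nrm A a * nrm X x"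
    using bounded_actionI[OF A B.complex_normed_space_axioms B.left_bounded] by blast
  obtain L where L: "L \<ge> 0"
    "\<And>a x. a \<in> carrier A \<Longrightarrow> x \<in> carrier X \<Longrightarrow> nrm X (r x a) \<le> L * nrm A a * nrm X x"
    using bounded_actionI[OF A B.complex_normed_space_axioms B.right_bounded] by blast
  have bl: "cmod (f (l a x)) \<le> (K * nrm A a * nrm (dual X) f) * nrm X x"
    if "f \<in> dual_carrier X" "a \<in> carrier A" "x \<in> carrier X" for f a x
    using order_trans[OF B.dual_bound[OF that(1) B.left_closed]
        mult_left_mono[OF K(2)[OF that(2,3)] B.dual_nrm_nonneg]] that
    by (simp add: ac_simps)
  have br: "cmod (f (r x a)) \<le> (L * nrm A a * nrm (dual X) f) * nrm X x"
    if "f \<in> dual_carrier X" "a \<in> carrier A" "x \<in> carrier X" for f a x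
    using order_trans[OF B.dual_bound[OF that(1) B.right_closed]
        mult_left_mono[OF L(2)[OF that(2,3)] B.dual_nrm_nonneg]] that
    by (simp add: ac_simps)
  show ?thesis
  proof (intro banach_bimodule.intro B.banach_dual banach_bimodule_axioms.intro)
    fix a f assume a: "a \<in> carrier A" and "f \<in> carrier (dual X)"
    then have f: "f \<in> dual_carrier X"
      by simp
    note simps [simp] = a dual_carrierD[OF f] B.left_closed B.right_closed
    show "dual_left X r a f \<in> carrier (dual X)"
      unfolding dual_left_def dual_simps using br[OF f a]
      by (intro dual_carrierI[where K = "L * nrm A a * nrm (dual X) f"])
        (simp_all add: B.right_add B.right_scale)
    show "dual_right X l f a \<in> carrier (dual X)"
      unfolding dual_right_def dual_simps using bl[OF f a]
      by (intro dual_carrierI[where K = "K * nrm A a * nrm (dual X) f"])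
        (simp_all add: B.left_add B.left_scale)
    show "dual_left X r a (z \<odot>\<^bsub>dual X\<^esub> f) = z \<odot>\<^bsub>dual X\<^esub> dual_left X r a f"
      "dual_right X l (z \<odot>\<^bsub>dual X\<^esub> f) a = z \<odot>\<^bsub>dual X\<^esub> dual_right X l f a"
      "dual_left X r (z \<odot>\<^bsub>A\<^esub> a) f = z \<odot>\<^bsub>dual X\<^esub> dual_left X r a f"
      "dual_right X l f (z \<odot>\<^bsub>A\<^esub> a) = z \<odot>\<^bsub>dual X\<^esub> dual_right X l f a" for z
      by (auto simp: dual_left_def dual_right_def B.left_scale_alg B.right_scale_alg)
    show "dual_left X r a (f \<oplus>\<^bsub>dual X\<^esub> g) = dual_left X r a f \<oplus>\<^bsub>dual X\<^esub> dual_left X r a g"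
      "dual_right X l (f \<oplus>\<^bsub>dual X\<^esub> g) a = dual_right X l f a \<oplus>\<^bsub>dual X\<^esub> dual_right X l g a"
      for g
      by (auto simp: dual_left_def dual_right_def)
    fix b assume b: "b \<in> carrier A"
    show "dual_left X r (a \<oplus>\<^bsub>A\<^esub> b) f = dual_left X r a f \<oplus>\<^bsub>dual X\<^esub> dual_left X r b f"
      "dual_right X l f (a \<oplus>\<^bsub>A\<^esub> b) = dual_right X l f a \<oplus>\<^bsub>dual X\<^esub> dual_right X l f b"
      "dual_left X r (a \<otimes>\<^bsub>A\<^esub> b) f = dual_left X r a (dual_left X r b f)"
      "dual_right X l f (a \<otimes>\<^bsub>A\<^esub> b) = dual_right X l (dual_right X l f a) b"
      "dual_right X l (dual_left X r a f) b = dual_left X r a (dual_right X l f b)"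
      using b by (auto simp: dual_left_def dual_right_def B.left_add_alg B.right_add_alg
          B.left_mult B.right_mult B.left_right)
  next
    show "\<exists>K. \<forall>a\<in>carrier A. \<forall>f\<in>carrier (dual X).
        nrm (dual X) (dual_left X r a f) \<le> K * nrm A a * nrm (dual X) f"
      using br L(1) by (intro exI[of _ L] ballI B.dual_nrm_le)
        (auto simp: dual_left_def A.nrm_nonneg B.dual_nrm_nonneg)
    show "\<exists>K. \<forall>a\<in>carrier A. \<forall>f\<in>carrier (dual X).
        nrm (dual X) (dual_right X l f a) \<le> K * nrm A a * nrm (dual X) f"
      using bl K(1) by (intro exI[of _ K] ballI B.dual_nrm_le)
        (auto simp: dual_right_def A.nrm_nonneg B.dual_nrm_nonneg)
  qed
qed

text \<open>Copies a space along an injection into another type, so that the bimodules quantified over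
  in \<^const>\<open>amenable\<close> include those on smaller types.\<close>

definition transport :: "('a \<Rightarrow> 'b) \<Rightarrow> 'a normed_module \<Rightarrow> 'b normed_module" where
  "transport h X = (let g = inv_into (carrier X) h in
     \<lparr>carrier = h ` carrier X, mult = undefined, one = undefined, zero = h \<zero>\<^bsub>X\<^esub>,
      add = (\<lambda>x y. h (g x \<oplus>\<^bsub>X\<^esub> g y)), smult = (\<lambda>c x. h (c \<odot>\<^bsub>X\<^esub> g x)), nrm = (\<lambda>x. nrm X (g x))\<rparr>)"

context complex_normed_space
begin

context
  fixes h :: "'a \<Rightarrow> 'b"
  assumes inj: "inj_on h (carrier X)"
begin

lemma transport_simps [simp]:
  "carrier (transport h X) = h ` carrier X"
  "\<zero>\<^bsub>transport h X\<^esub> = h \<zero>"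
  "x \<in> carrier X \<Longrightarrow> y \<in> carrier X \<Longrightarrow> h x \<oplus>\<^bsub>transport h X\<^esub> h y = h (x \<oplus> y)"
  "x \<in> carrier X \<Longrightarrow> c \<odot>\<^bsub>transport h X\<^esub> h x = h (c \<odot> x)"
  "x \<in> carrier X \<Longrightarrow> nrm (transport h X) (h x) = nrm X x"
  by (simp_all add: transport_def Let_def inj)

lemma transport_eq_iff:
  "x \<in> carrier X \<Longrightarrow> y \<in> carrier X \<Longrightarrow> h x = h y \<longleftrightarrow> x = y"
  using inj by (rule inj_on_eq_iff)

lemma normed_space_transport: "complex_normed_space (transport h X)"
  by (rule complex_normed_spaceI)
    (auto simp: a_ac scale_add_left scale_add_right scale_scale nrm_nonneg nrm_eq_zero
      transport_eq_iff nrm_triangle nrm_scale)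

lemma transport_minus:
  assumes "x \<in> carrier X" "y \<in> carrier X"
  shows "h x \<ominus>\<^bsub>transport h X\<^esub> h y = h (x \<ominus> y)"
  using assms
  by (intro complex_normed_space.minus_unique normed_space_transport) (auto simp: minus_add_cancel)

end

end

lemma (in banach_space) banach_space_transport:
  assumes inj: "inj_on h (carrier X)"
  shows "banach_space (transport h X)"
proof (rule banach_spaceI[OF normed_space_transport[OF inj]])
  note [simp] = transport_simps[OF inj] transport_minus[OF inj]
  fix s :: "nat \<Rightarrow> 'b"
  assume "range s \<subseteq> carrier (transport h X)"
    and Cauchy: "\<And>e. e > 0 \<Longrightarrow>
      \<exists>N. \<forall>m\<ge>N. \<forall>n\<ge>N. nrm (transport h X) (s m \<ominus>\<^bsub>transport h X\<^esub> s n) < e"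
  then have "s n \<in> h ` carrier X" for n
    by auto
  then have "\<forall>n. \<exists>x\<in>carrier X. s n = h x"
    by blast
  then obtain t where t: "\<And>n. t n \<in> carrier X" and s: "\<And>n. s n = h (t n)"
    by metis
  have "range t \<subseteq> carrier X"
    using t by blast
  moreover have "\<forall>e>0. \<exists>N. \<forall>m\<ge>N. \<forall>n\<ge>N. nrm X (t m \<ominus> t n) < e"
    using Cauchy t by (simp add: s)
  ultimately have "\<exists>x\<in>carrier X. \<forall>e>0. \<exists>N. \<forall>n\<ge>N. nrm X (t n \<ominus> x) < e"
    by (rule complete[unfolded mcomplete_iff, THEN spec, THEN mp, THEN mp])
  then obtain x where "x \<in> carrier X" "\<forall>e>0. \<exists>N. \<forall>n\<ge>N. nrm X (t n \<ominus> x) < e"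
    by (rule bexE)
  then show "\<exists>x\<in>carrier (transport h X).
      \<forall>e>0. \<exists>N. \<forall>n\<ge>N. nrm (transport h X) (s n \<ominus>\<^bsub>transport h X\<^esub> x) < e"
    using t by (intro bexI[of _ "h x"]) (simp_all add: s)
qed

lemma (in banach_bimodule) banach_bimodule_transport:
  assumes inj: "inj_on h (carrier X)"
  defines "g \<equiv> inv_into (carrier X) h"
  shows "banach_bimodule A (transport h X) (\<lambda>a x. h (l a (g x))) (\<lambda>x a. h (r (g x) a))"
proof -
  have gh: "g (h x) = x" if "x \<in> carrier X" for x
    using inj that by (simp add: g_def)
  note [simp] = gh transport_simps[OF inj] left_closed right_closed
  show ?thesis
  proof (intro banach_bimodule.intro banach_space_transport inj banach_bimodule_axioms.intro)
    show "\<exists>K. \<forall>a\<in>carrier A. \<forall>x\<in>carrier (transport h X).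
        nrm (transport h X) (h (l a (g x))) \<le> K * nrm A a * nrm (transport h X) x"
      using left_bounded by simp
    show "\<exists>K. \<forall>a\<in>carrier A. \<forall>x\<in>carrier (transport h X).
        nrm (transport h X) (h (r (g x) a)) \<le> K * nrm A a * nrm (transport h X) x"
      using right_bounded by simp
  qed (simp only: transport_simps(1)[OF inj], elim imageE, simp add: left_add right_add left_add_alg
      right_add_alg left_scale right_scale left_scale_alg right_scale_alg left_mult right_mult
      left_right)+
qed

text \<open>Makes \<open>amenable\<close> applicable to any bimodule that injects into the type
  fixed there: bimodule and derivation are copied along \<open>h\<close>, and the implementing
  functional is pulled back. By the definition of the dual actions, the value of a \<xi> - \<xi> a
  at x is \<xi>(x a) - \<xi>(a x).\<close>

lemma amenable_inner:
  fixes C :: "'a normed_module" and X :: "'b normed_module" and h :: "'b \<Rightarrow> 'a \<Rightarrow> 'a \<Rightarrow> complex"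
  assumes "amenable C" and C: "complex_normed_space C"
    and X: "banach_bimodule C X l r" and inj: "inj_on h (carrier X)"
    and D: "continuous_derivation C (dual X) (dual_left X r) (dual_right X l) D"
  shows "\<exists>\<xi>\<in>dual_carrier X. \<forall>a\<in>carrier C. \<forall>x\<in>carrier X. D a x = \<xi> (r x a) - \<xi> (l a x)"
proof -
  interpret C: complex_normed_space C
    by fact
  interpret X: banach_bimodule C X l r
    by fact
  define g where "g = inv_into (carrier X) h"
  define T where "T = transport h X"
  define l' where "l' = (\<lambda>a y. h (l a (g y)))"
  define r' where "r' = (\<lambda>y a. h (r (g y) a))"
  define D' where "D' a = (\<lambda>y\<in>carrier T. D a (g y))" for a
  have gh [simp]: "g (h x) = x" if "x \<in> carrier X" for x
    using inj that by (simp add: g_def)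
  note T_simps [simp] = X.transport_simps[OF inj, folded T_def]
  note closed [simp] = X.left_closed X.right_closed
  have T: "banach_bimodule C T l' r'"
    unfolding T_def l'_def r'_def g_def by (rule X.banach_bimodule_transport[OF inj])
  interpret T: banach_bimodule C T l' r'
    by fact
  interpret T': banach_bimodule C "dual T" "dual_left T r'" "dual_right T l'"
    by (rule dual_banach_bimodule[OF C T])
  obtain K where K: "\<And>a. a \<in> carrier C \<Longrightarrow> nrm (dual X) (D a) \<le> K * nrm C a"
    using D unfolding continuous_derivation_def by blast
  have D_dual: "D a \<in> dual_carrier X" if "a \<in> carrier C" for a
    using D that unfolding continuous_derivation_def by auto
  have D'_h: "D' a (h x) = D a x" if "x \<in> carrier X" for a x
    using that by (simp add: D'_def)
  have D'_dual: "D' a \<in> dual_carrier T" if "a \<in> carrier C" for a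
  proof (rule dual_carrierI)
    show "cmod (D' a y) \<le> nrm (dual X) (D a) * nrm T y" if "y \<in> carrier T" for y
      using X.dual_bound[OF D_dual[OF \<open>a \<in> carrier C\<close>]] that by (auto simp: D'_h)
    show "D' a \<in> extensional (carrier T)"
      by (simp add: D'_def)
  qed (use dual_carrierD[OF D_dual[OF that]] in \<open>auto simp: D'_h\<close>)
  have D'_nrm: "nrm (dual T) (D' a) \<le> K * nrm C a" if a: "a \<in> carrier C" for a
  proof -
    have "nrm (dual T) (D' a) \<le> nrm (dual X) (D a)"
      using X.dual_bound[OF D_dual[OF a]] X.dual_nrm_nonneg[OF D_dual[OF a]]
      by (intro T.dual_nrm_le) (auto simp: D'_def)
    then show ?thesis
      using K[OF a] by simp
  qed
  have "continuous_derivation C (dual T) (dual_left T r') (dual_right T l') D'"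
    unfolding continuous_derivation_def
  proof (intro conjI ballI allI)
    show "D' \<in> carrier C \<rightarrow> carrier (dual T)"
      using D'_dual by simp
    show "\<exists>K. \<forall>a\<in>carrier C. nrm (dual T) (D' a) \<le> K * nrm C a"
      using D'_nrm by blast
    fix a b z assume ab: "a \<in> carrier C" "b \<in> carrier C"
    have "D (a \<oplus>\<^bsub>C\<^esub> b) = D a \<oplus>\<^bsub>dual X\<^esub> D b" "D (z \<odot>\<^bsub>C\<^esub> a) = z \<odot>\<^bsub>dual X\<^esub> D a"
      "D (a \<otimes>\<^bsub>C\<^esub> b) = dual_left X r a (D b) \<oplus>\<^bsub>dual X\<^esub> dual_right X l (D a) b"
      using D ab unfolding continuous_derivation_def by blast+
    then have *: "D (a \<oplus>\<^bsub>C\<^esub> b) x = D a x + D b x" "D (z \<odot>\<^bsub>C\<^esub> a) x = z * D a x"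
      "D (a \<otimes>\<^bsub>C\<^esub> b) x = D b (r x a) + D a (l b x)" if "x \<in> carrier X" for x
      using that by (simp_all add: dual_left_def dual_right_def)
    show "D' (a \<oplus>\<^bsub>C\<^esub> b) = D' a \<oplus>\<^bsub>dual T\<^esub> D' b"
      by (rule dual_eqI[of _ T]) (auto simp: D'_h *, simp_all add: D'_def)
    show "D' (z \<odot>\<^bsub>C\<^esub> a) = z \<odot>\<^bsub>dual T\<^esub> D' a"
      by (rule dual_eqI[of _ T]) (auto simp: D'_h *, simp_all add: D'_def)
    show "D' (a \<otimes>\<^bsub>C\<^esub> b) = dual_left T r' a (D' b) \<oplus>\<^bsub>dual T\<^esub> dual_right T l' (D' a) b"
      using ab by (intro dual_eqI[of _ T])
        (auto simp: D'_h * dual_left_def dual_right_def l'_def r'_def, simp_all add: D'_def)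
  qed
  then obtain \<psi> where \<psi>: "\<psi> \<in> dual_carrier T"
    and inner: "\<And>a. a \<in> carrier C \<Longrightarrow> D' a = dual_left T r' a \<psi> \<ominus>\<^bsub>dual T\<^esub> dual_right T l' \<psi> a"
    using assms(1) T unfolding amenable_def inner_derivation_def by (metis dual_simps(1))
  define \<xi> where "\<xi> = (\<lambda>x\<in>carrier X. \<psi> (h x))"
  have "\<xi> \<in> dual_carrier X"
  proof (rule dual_carrierI)
    show "cmod (\<xi> x) \<le> nrm (dual T) \<psi> * nrm X x" if "x \<in> carrier X" for x
      using T.dual_bound[OF \<psi>, of "h x"] that by (simp add: \<xi>_def)
    show "\<xi> (x \<oplus>\<^bsub>X\<^esub> y) = \<xi> x + \<xi> y" if "x \<in> carrier X" "y \<in> carrier X" for x y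
      using dual_carrierD(2)[OF \<psi>, of "h x" "h y"] that by (simp add: \<xi>_def)
    show "\<xi> (c \<odot>\<^bsub>X\<^esub> x) = c * \<xi> x" if "x \<in> carrier X" for c x
      using dual_carrierD(3)[OF \<psi>, of "h x" c] that by (simp add: \<xi>_def)
  qed (simp add: \<xi>_def)
  moreover have "D a x = \<xi> (r x a) - \<xi> (l a x)" if a: "a \<in> carrier C" and x: "x \<in> carrier X" for a x
  proof -
    have "D a x = D' a (h x)"
      using x by (simp add: D'_h)
    also have "\<dots> = dual_left T r' a \<psi> (h x) - dual_right T l' \<psi> a (h x)"
      unfolding inner[OF a]
      using T'.left_closed[OF a] T'.right_closed[OF a] \<psi> x by (intro T.dual_minus_apply) simp_all
    finally show ?thesis
      using a x by (simp add: dual_left_def dual_right_def l'_def r'_def \<xi>_def)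
  qed
  ultimately show ?thesis
    by blast
qed

section \<open>Differences of homomorphisms\<close>

definition bounded_hom :: "'a normed_module \<Rightarrow> ('a \<Rightarrow> 'a) \<Rightarrow> bool" where
  "bounded_hom A p \<longleftrightarrow> p \<in> carrier A \<rightarrow> carrier A \<and>
     (\<forall>a\<in>carrier A. \<forall>b\<in>carrier A. p (a \<oplus>\<^bsub>A\<^esub> b) = p a \<oplus>\<^bsub>A\<^esub> p b) \<and>
     (\<forall>z. \<forall>a\<in>carrier A. p (z \<odot>\<^bsub>A\<^esub> a) = z \<odot>\<^bsub>A\<^esub> p a) \<and>
     (\<forall>a\<in>carrier A. \<forall>b\<in>carrier A. p (a \<otimes>\<^bsub>A\<^esub> b) = p a \<otimes>\<^bsub>A\<^esub> p b) \<and>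
     (\<exists>K. \<forall>a\<in>carrier A. nrm A (p a) \<le> K * nrm A a)"

context banach_algebra
begin

lemma mult_zero [simp]:
  assumes "a \<in> carrier A"
  shows "\<zero> \<otimes> a = \<zero>" "a \<otimes> \<zero> = \<zero>"
  using assms mult_scale_left[of \<zero> a 0] mult_scale_right[of a \<zero> 0] mult_closed[of \<zero> a]
    mult_closed[of a \<zero>] by simp_all

lemma bounded_hom_id: "bounded_hom A (\<lambda>a. a)"
  unfolding bounded_hom_def by (auto intro: exI[of _ 1])

lemma bounded_hom_zero: "bounded_hom A (\<lambda>a. \<zero>)"
  unfolding bounded_hom_def by (auto intro: exI[of _ 0])

text \<open>The difference of two homomorphisms \<open>\<pi>\<close> and \<open>\<rho>\<close> with values in the ideal \<open>I\<close> is a derivation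
  when the algebra acts on \<open>I\<close> through \<open>\<pi>\<close> from the left and through \<open>\<rho>\<close> from the right; it becomes
  inner in the second dual of \<open>I\<close>.\<close>

lemma hom_difference_inner:
  assumes amenable: "amenable A" and J: "banach_space (A\<lparr>carrier := I\<rparr>)"
    and I: "I \<subseteq> carrier A"
    and ideal: "\<And>a i. a \<in> carrier A \<Longrightarrow> i \<in> I \<Longrightarrow> a \<otimes> i \<in> I \<and> i \<otimes> a \<in> I"
    and \<pi>: "bounded_hom A \<pi>" and \<rho>: "bounded_hom A \<rho>"
    and diff: "\<And>a. a \<in> carrier A \<Longrightarrow> \<rho> a \<ominus> \<pi> a \<in> I"
  shows "\<exists>\<xi>\<in>dual_carrier (dual (A\<lparr>carrier := I\<rparr>)).
    \<forall>a\<in>carrier A. \<forall>\<phi>\<in>dual_carrier (A\<lparr>carrier := I\<rparr>).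
      \<phi> (\<rho> a \<ominus> \<pi> a) = \<xi> (\<lambda>i\<in>I. \<phi> (\<pi> a \<otimes> i)) - \<xi> (\<lambda>i\<in>I. \<phi> (i \<otimes> \<rho> a))"
proof -
  define J where "J = A\<lparr>carrier := I\<rparr>"
  define d where "d a = \<rho> a \<ominus> \<pi> a" for a
  define l where "l a i = \<pi> a \<otimes> i" for a i
  define r where "r i a = i \<otimes> \<rho> a" for a i
  \<comment> \<open>The image of \<open>d a\<close> under the canonical embedding of
    \<open>J\<close> into its second dual.\<close>
  define D where "D a = (\<lambda>\<phi>\<in>dual_carrier J. \<phi> (d a))" for a
  interpret J: banach_space J
    unfolding J_def by (rule J)
  have J_simps [simp]: "carrier J = I" "x \<oplus>\<^bsub>J\<^esub> y = x \<oplus> y" "z \<odot>\<^bsub>J\<^esub> x = z \<odot> x" "nrm J x = nrm A x"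
    for x y z
    by (simp_all add: J_def)
  have IA [simp]: "i \<in> carrier A" if "i \<in> I" for i
    using I that by blast
  have h [simp]: "\<pi> a \<in> carrier A" "\<rho> a \<in> carrier A"
    "\<pi> (z \<odot> a) = z \<odot> \<pi> a" "\<rho> (z \<odot> a) = z \<odot> \<rho> a" if "a \<in> carrier A" for a z
    using \<pi> \<rho> that unfolding bounded_hom_def by auto
  have h2 [simp]: "\<pi> (a \<oplus> b) = \<pi> a \<oplus> \<pi> b" "\<rho> (a \<oplus> b) = \<rho> a \<oplus> \<rho> b"
    "\<pi> (a \<otimes> b) = \<pi> a \<otimes> \<pi> b" "\<rho> (a \<otimes> b) = \<rho> a \<otimes> \<rho> b"
    if "a \<in> carrier A" "b \<in> carrier A" for a b
    using \<pi> \<rho> that unfolding bounded_hom_def by auto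
  obtain K L where K: "\<And>a. a \<in> carrier A \<Longrightarrow> nrm A (\<pi> a) \<le> K * nrm A a"
    and L: "\<And>a. a \<in> carrier A \<Longrightarrow> nrm A (\<rho> a) \<le> L * nrm A a"
    using \<pi> \<rho> unfolding bounded_hom_def by metis
  have dI [simp]: "d a \<in> I" if "a \<in> carrier A" for a
    using diff[OF that] by (simp add: d_def)
  have d_plus: "d a \<oplus> \<pi> a = \<rho> a" if "a \<in> carrier A" for a
    using that by (simp add: d_def minus_add_cancel)
  have d_eqI: "d a = x" if "a \<in> carrier A" "x \<in> carrier A" "x \<oplus> \<pi> a = \<rho> a" for a x
    unfolding d_def using that by (intro minus_unique) auto
  have d_scale: "d (z \<odot> a) = z \<odot> d a" if "a \<in> carrier A" for a z
    using that by (intro d_eqI) (simp_all add: scale_add_right[symmetric] d_plus)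
  have d_add: "d (a \<oplus> b) = d a \<oplus> d b" if ab: "a \<in> carrier A" "b \<in> carrier A" for a b
  proof (rule d_eqI)
    have "d a \<oplus> d b \<oplus> (\<pi> a \<oplus> \<pi> b) = (d a \<oplus> \<pi> a) \<oplus> (d b \<oplus> \<pi> b)"
      using ab by (simp add: a_ac)
    then show "d a \<oplus> d b \<oplus> \<pi> (a \<oplus> b) = \<rho> (a \<oplus> b)"
      using ab by (simp add: d_plus)
  qed (use ab in auto)
  \<comment> \<open>Insert the mixed term: \<rho>(a) \<rho>(b) - \<pi>(a) \<pi>(b) = \<pi>(a)
    (\<rho>(b) - \<pi>(b)) + (\<rho>(a) - \<pi>(a)) \<rho>(b).\<close>
  have d_mult: "d (a \<otimes> b) = \<pi> a \<otimes> d b \<oplus> d a \<otimes> \<rho> b"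
    if ab: "a \<in> carrier A" "b \<in> carrier A" for a b
  proof (rule d_eqI)
    have "\<pi> a \<otimes> d b \<oplus> d a \<otimes> \<rho> b \<oplus> \<pi> a \<otimes> \<pi> b = d a \<otimes> \<rho> b \<oplus> (\<pi> a \<otimes> d b \<oplus> \<pi> a \<otimes> \<pi> b)"
      using ab by (simp add: a_ac mult_closed)
    also have "\<dots> = (d a \<oplus> \<pi> a) \<otimes> \<rho> b"
      using ab by (simp add: mult_add_right[symmetric] d_plus) (simp add: mult_add_left[symmetric] d_plus)
    finally show "\<pi> a \<otimes> d b \<oplus> d a \<otimes> \<rho> b \<oplus> \<pi> (a \<otimes> b) = \<rho> (a \<otimes> b)"
      using ab by (simp add: d_plus)
  qed (use ab in \<open>simp_all add: mult_closed\<close>)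
  have d_bound: "nrm A (d a) \<le> (L + K) * nrm A a" if "a \<in> carrier A" for a
  proof -
    have "nrm A (d a) \<le> nrm A (\<rho> a) + nrm A ((- 1) \<odot> \<pi> a)"
      unfolding d_def minus_eq using that nrm_triangle[of "\<rho> a" "(- 1) \<odot> \<pi> a"]
      by (simp add: scale_minus_one)
    then show ?thesis
      using K[OF that] L[OF that] that by (simp add: nrm_scale distrib_right)
  qed
  have bimodule: "banach_bimodule A J l r"
  proof (intro banach_bimodule.intro J.banach_space_axioms banach_bimodule_axioms.intro)
    show "\<exists>K. \<forall>a\<in>carrier A. \<forall>x\<in>carrier J. nrm J (l a x) \<le> K * nrm A a * nrm J x"
    proof (intro exI[of _ K] ballI)
      fix a x assume "a \<in> carrier A" "x \<in> carrier J"
      then show "nrm J (l a x) \<le> K * nrm A a * nrm J x"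
        using nrm_mult[of "\<pi> a" x] mult_right_mono[OF K[of a] nrm_nonneg[of x]]
        by (simp add: l_def)
    qed
    show "\<exists>K. \<forall>a\<in>carrier A. \<forall>x\<in>carrier J. nrm J (r x a) \<le> K * nrm A a * nrm J x"
    proof (intro exI[of _ L] ballI)
      fix a x assume "a \<in> carrier A" "x \<in> carrier J"
      then show "nrm J (r x a) \<le> L * nrm A a * nrm J x"
        using nrm_mult[of x "\<rho> a"] mult_left_mono[OF L[of a] nrm_nonneg[of x]]
        by (simp add: r_def ac_simps)
    qed
  qed (auto simp: l_def r_def ideal mult_add_left mult_add_right mult_scale_left mult_scale_right
      mult_assoc)
  interpret B: banach_bimodule A J l r
    by (rule bimodule)
  have bimodule': "banach_bimodule A (dual J) (dual_left J r) (dual_right J l)"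
    by (rule dual_banach_bimodule[OF complex_normed_space_axioms bimodule])
  interpret B': banach_bimodule A "dual J" "dual_left J r" "dual_right J l"
    by (rule bimodule')
  have D_dual: "D a \<in> dual_carrier (dual J)" if "a \<in> carrier A" for a
  proof (rule dual_carrierI)
    show "cmod (D a \<phi>) \<le> nrm A (d a) * nrm (dual J) \<phi>" if "\<phi> \<in> carrier (dual J)" for \<phi>
      using J.dual_bound[of \<phi> "d a"] that \<open>a \<in> carrier A\<close> by (simp add: D_def mult.commute)
    show "D a (\<phi> \<oplus>\<^bsub>dual J\<^esub> \<psi>) = D a \<phi> + D a \<psi>"
      if "\<phi> \<in> carrier (dual J)" "\<psi> \<in> carrier (dual J)" for \<phi> \<psi>
      using B'.a_closed[OF that] that \<open>a \<in> carrier A\<close> by (simp add: D_def)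
    show "D a (c \<odot>\<^bsub>dual J\<^esub> \<phi>) = c * D a \<phi>" if "\<phi> \<in> carrier (dual J)" for c \<phi>
      using B'.scale_closed[OF that, of c] that \<open>a \<in> carrier A\<close> by (simp add: D_def)
  qed (simp add: D_def)
  \<comment> \<open>The bimodule handed to amenability is \<open>dual J\<close>, so that
    \<open>D\<close> has values in the dual of a bimodule. Dualizing twice restores the sides: these
    actions extend \<open>l\<close> and \<open>r\<close> from \<open>J\<close> to its second
    dual.\<close>
  have "continuous_derivation A (dual (dual J)) (dual_left (dual J) (dual_right J l))
      (dual_right (dual J) (dual_left J r)) D"
    unfolding continuous_derivation_def
  proof (intro conjI ballI allI)
    show "D \<in> carrier A \<rightarrow> carrier (dual (dual J))"
      using D_dual by simp
    have "nrm (dual (dual J)) (D a) \<le> nrm A (d a)" if "a \<in> carrier A" for a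
      using J.dual_bound[of _ "d a"] that
      by (intro B'.dual_nrm_le) (auto simp: D_def nrm_nonneg mult.commute)
    then show "\<exists>K. \<forall>a\<in>carrier A. nrm (dual (dual J)) (D a) \<le> K * nrm A a"
      using d_bound by (meson order_trans)
    fix a b z assume ab: "a \<in> carrier A" "b \<in> carrier A"
    show "D (a \<oplus> b) = D a \<oplus>\<^bsub>dual (dual J)\<^esub> D b"
      using ab by (auto simp: D_def d_add dual_carrierD(2)[of _ J, simplified])
    show "D (z \<odot> a) = z \<odot>\<^bsub>dual (dual J)\<^esub> D a"
      using ab by (auto simp: D_def d_scale dual_carrierD(3)[of _ J, simplified])
    show "D (a \<otimes> b) = dual_left (dual J) (dual_right J l) a (D b) \<oplus>\<^bsub>dual (dual J)\<^esub>
        dual_right (dual J) (dual_left J r) (D a) b"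
    proof (rule dual_eqI[of _ "dual J"])
      fix \<phi> assume \<phi>: "\<phi> \<in> carrier (dual J)"
      then have "D (a \<otimes> b) \<phi> = \<phi> (\<pi> a \<otimes> d b) + \<phi> (d a \<otimes> \<rho> b)"
        using ab ideal by (simp add: D_def d_mult dual_carrierD(2)[of _ J, simplified])
      moreover have "dual_left (dual J) (dual_right J l) a (D b) \<phi> = \<phi> (\<pi> a \<otimes> d b)"
        using \<phi> ab B'.right_closed[OF ab(1) \<phi>] unfolding dual_left_def
        by (simp add: D_def) (simp add: dual_right_def l_def)
      moreover have "dual_right (dual J) (dual_left J r) (D a) b \<phi> = \<phi> (d a \<otimes> \<rho> b)"
        using \<phi> ab B'.left_closed[OF ab(2) \<phi>] unfolding dual_right_def
        by (simp add: D_def) (simp add: dual_left_def r_def)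
      ultimately show "D (a \<otimes> b) \<phi> = (dual_left (dual J) (dual_right J l) a (D b)
          \<oplus>\<^bsub>dual (dual J)\<^esub> dual_right (dual J) (dual_left J r) (D a) b) \<phi>"
        using \<phi> by simp
    qed (simp_all add: D_def)
  qed
  \<comment> \<open>A functional is placed in the type used by \<open>amenable\<close> as a function
    that ignores its first argument.\<close>
  moreover have "inj_on (\<lambda>\<phi> (_ :: 'a). \<phi>) (carrier (dual J))"
    by (rule inj_onI) (drule fun_cong, assumption)
  ultimately
  obtain \<xi> where "\<xi> \<in> dual_carrier (dual J)"
    "\<And>a \<phi>. a \<in> carrier A \<Longrightarrow> \<phi> \<in> dual_carrier J \<Longrightarrow>
      D a \<phi> = \<xi> (dual_right J l \<phi> a) - \<xi> (dual_left J r a \<phi>)"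
    using amenable_inner[OF amenable complex_normed_space_axioms bimodule'] by fastforce
  then show ?thesis
    unfolding J_def[symmetric]
    by (intro bexI[of _ \<xi>] ballI) (simp_all add: D_def d_def dual_left_def dual_right_def l_def r_def)
qed

end

section \<open>The second dual as a Banach algebra\<close>

lemma bidual_simps [simp]:
  "carrier (bidual A) = dual_carrier (dual A)"
  "\<zero>\<^bsub>bidual A\<^esub> = (\<lambda>f\<in>dual_carrier A. 0)"
  "m \<oplus>\<^bsub>bidual A\<^esub> n = (\<lambda>f\<in>dual_carrier A. m f + n f)"
  "c \<odot>\<^bsub>bidual A\<^esub> m = (\<lambda>f\<in>dual_carrier A. c * m f)"
  "m \<otimes>\<^bsub>bidual A\<^esub> n = arens_mult A m n"
  "nrm (bidual A) m = nrm (dual (dual A)) m"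
  by (simp_all add: bidual_def dual_def)

context banach_algebra
begin

sublocale dual: banach_space "dual A"
  by (rule banach_dual)

lemma functional_act_closed:
  assumes "f \<in> dual_carrier A" "a \<in> carrier A"
  shows "functional_act A f a \<in> dual_carrier A"
    and "nrm (dual A) (functional_act A f a) \<le> nrm (dual A) f * nrm A a"
proof -
  have *: "cmod (functional_act A f a b) \<le> (nrm (dual A) f * nrm A a) * nrm A b"
    if "b \<in> carrier A" for b
    using order_trans[OF dual_bound[of f "a \<otimes> b"]
        mult_left_mono[OF nrm_mult[of a b] dual_nrm_nonneg[of f]]] assms that
    by (simp add: functional_act_def mult_closed mult.assoc)
  then show "functional_act A f a \<in> dual_carrier A"
    using assms
    by (intro dual_carrierI[where K = "nrm (dual A) f * nrm A a"])
      (simp_all add: functional_act_def dual_carrierD[OF assms(1)] mult_closed mult_add_right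
        mult_scale_right)
  show "nrm (dual A) (functional_act A f a) \<le> nrm (dual A) f * nrm A a"
    using * assms dual_nrm_nonneg nrm_nonneg by (intro dual_nrm_le) auto
qed

lemma bidual_act_closed:
  assumes m: "m \<in> dual_carrier (dual A)" and f: "f \<in> dual_carrier A"
  shows "bidual_act A m f \<in> dual_carrier A"
    and "nrm (dual A) (bidual_act A m f) \<le> nrm (dual (dual A)) m * nrm (dual A) f"
proof -
  have *: "cmod (bidual_act A m f a) \<le> (nrm (dual (dual A)) m * nrm (dual A) f) * nrm A a"
    if "a \<in> carrier A" for a
    using order_trans[OF dual.dual_bound[OF m, of "functional_act A f a"]
        mult_left_mono[OF functional_act_closed(2)[OF f that] dual.dual_nrm_nonneg[OF m]]]
      functional_act_closed(1)[OF f that] that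
    by (simp add: bidual_act_def mult.assoc)
  have add: "functional_act A f (a \<oplus> b) = functional_act A f a \<oplus>\<^bsub>dual A\<^esub> functional_act A f b"
    if "a \<in> carrier A" "b \<in> carrier A" for a b
    using that dual_carrierD[OF f] by (auto simp: functional_act_def mult_add_left mult_closed)
  have scale: "functional_act A f (c \<odot> a) = c \<odot>\<^bsub>dual A\<^esub> functional_act A f a"
    if "a \<in> carrier A" for a c
    using that dual_carrierD[OF f] by (auto simp: functional_act_def mult_scale_left mult_closed)
  show "bidual_act A m f \<in> dual_carrier A"
  proof (rule dual_carrierI)
    show "bidual_act A m f (a \<oplus> b) = bidual_act A m f a + bidual_act A m f b"
      if "a \<in> carrier A" "b \<in> carrier A" for a b
      using that dual_carrierD(2)[OF m] functional_act_closed(1)[OF f]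
      by (simp add: bidual_act_def add del: dual_simps(2-))
    show "bidual_act A m f (c \<odot> a) = c * bidual_act A m f a" if "a \<in> carrier A" for c a
      using that dual_carrierD(3)[OF m] functional_act_closed(1)[OF f]
      by (simp add: bidual_act_def scale del: dual_simps(2-))
  qed (use * in \<open>simp_all add: bidual_act_def\<close>)
  show "nrm (dual A) (bidual_act A m f) \<le> nrm (dual (dual A)) m * nrm (dual A) f"
    using * dual_nrm_nonneg[OF f] dual.dual_nrm_nonneg[OF m] by (intro dual_nrm_le) auto
qed

lemma arens_mult_apply:
  "f \<in> dual_carrier A \<Longrightarrow> arens_mult A m n f = m (bidual_act A n f)"
  by (simp add: arens_mult_def)

lemma bidual_act_add:
  assumes "n \<in> dual_carrier (dual A)" "f \<in> dual_carrier A" "g \<in> dual_carrier A"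
  shows "bidual_act A n (f \<oplus>\<^bsub>dual A\<^esub> g) = bidual_act A n f \<oplus>\<^bsub>dual A\<^esub> bidual_act A n g"
proof -
  have "functional_act A (f \<oplus>\<^bsub>dual A\<^esub> g) a = functional_act A f a \<oplus>\<^bsub>dual A\<^esub> functional_act A g a"
    if "a \<in> carrier A" for a
    using that by (auto simp: functional_act_def mult_closed)
  then have "n (functional_act A (f \<oplus>\<^bsub>dual A\<^esub> g) a) = n (functional_act A f a) + n (functional_act A g a)"
    if "a \<in> carrier A" for a
    using that dual_carrierD(2)[OF assms(1)] functional_act_closed(1)[of _ a] assms(2,3)
    by (simp del: dual_simps(3))
  then show ?thesis
    by (intro dual_eqI[of _ A]) (simp_all add: bidual_act_def)
qed

lemma bidual_act_scale:
  assumes "n \<in> dual_carrier (dual A)" "f \<in> dual_carrier A"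
  shows "bidual_act A n (c \<odot>\<^bsub>dual A\<^esub> f) = c \<odot>\<^bsub>dual A\<^esub> bidual_act A n f"
proof -
  have "functional_act A (c \<odot>\<^bsub>dual A\<^esub> f) a = c \<odot>\<^bsub>dual A\<^esub> functional_act A f a"
    if "a \<in> carrier A" for a
    using that by (auto simp: functional_act_def mult_closed)
  then have "n (functional_act A (c \<odot>\<^bsub>dual A\<^esub> f) a) = c * n (functional_act A f a)"
    if "a \<in> carrier A" for a
    using that dual_carrierD(3)[OF assms(1)] functional_act_closed(1)[of _ a] assms(2)
    by (simp del: dual_simps(4))
  then show ?thesis
    by (intro dual_eqI[of _ A]) (simp_all add: bidual_act_def)
qed

lemma arens_mult_closed:
  assumes m: "m \<in> dual_carrier (dual A)" and n: "n \<in> dual_carrier (dual A)"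
  shows "arens_mult A m n \<in> dual_carrier (dual A)"
    and "nrm (dual (dual A)) (arens_mult A m n) \<le> nrm (dual (dual A)) m * nrm (dual (dual A)) n"
proof -
  have *: "cmod (arens_mult A m n f) \<le>
      (nrm (dual (dual A)) m * nrm (dual (dual A)) n) * nrm (dual A) f"
    if "f \<in> carrier (dual A)" for f
    using order_trans[OF dual.dual_bound[OF m, of "bidual_act A n f"]
        mult_left_mono[OF bidual_act_closed(2)[OF n] dual.dual_nrm_nonneg[OF m]]]
      bidual_act_closed(1)[OF n] that
    by (simp add: arens_mult_def mult.assoc)
  show "arens_mult A m n \<in> dual_carrier (dual A)"
  proof (rule dual_carrierI)
    show "arens_mult A m n (f \<oplus>\<^bsub>dual A\<^esub> g) = arens_mult A m n f + arens_mult A m n g"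
      if "f \<in> carrier (dual A)" "g \<in> carrier (dual A)" for f g
      using that dual.a_closed[OF that] bidual_act_add[OF n] dual_carrierD(2)[OF m]
        bidual_act_closed(1)[OF n]
      by (simp add: arens_mult_def del: dual_simps(3))
    show "arens_mult A m n (c \<odot>\<^bsub>dual A\<^esub> f) = c * arens_mult A m n f"
      if "f \<in> carrier (dual A)" for c f
      using that dual.scale_closed[OF that, of c] bidual_act_scale[OF n] dual_carrierD(3)[OF m]
        bidual_act_closed(1)[OF n]
      by (simp add: arens_mult_def del: dual_simps(4))
  qed (use * in \<open>simp_all add: arens_mult_def\<close>)
  show "nrm (dual (dual A)) (arens_mult A m n) \<le> nrm (dual (dual A)) m * nrm (dual (dual A)) n"
    using * dual.dual_nrm_nonneg m n by (intro dual.dual_nrm_le) auto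
qed

text \<open>Associativity of the Arens product in terms of its action on functionals. It rests on
  (n.f).a = n.(f.a), which in turn comes from (f.a).b = f.(ab), the associativity of A.\<close>

lemma bidual_act_arens:
  assumes "m \<in> dual_carrier (dual A)" "n \<in> dual_carrier (dual A)" "f \<in> dual_carrier A"
  shows "bidual_act A (arens_mult A m n) f = bidual_act A m (bidual_act A n f)"
proof (rule dual_eqI[of _ A])
  fix a assume a: "a \<in> carrier A"
  have "functional_act A (bidual_act A n f) a = bidual_act A n (functional_act A f a)"
  proof (rule dual_eqI[of _ A])
    fix b assume b: "b \<in> carrier A"
    have "functional_act A (functional_act A f a) b = functional_act A f (a \<otimes> b)"
      using a b by (auto simp: functional_act_def mult_closed mult_assoc)
    then show "functional_act A (bidual_act A n f) a b = bidual_act A n (functional_act A f a) b"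
      using a b by (simp add: bidual_act_def mult_closed) (simp add: functional_act_def mult_closed)
  qed (simp_all add: functional_act_def bidual_act_def)
  then show "bidual_act A (arens_mult A m n) f a = bidual_act A m (bidual_act A n f) a"
    using a functional_act_closed(1)[OF assms(3) a] by (simp add: bidual_act_def[of _ _ f]
      bidual_act_def[of _ m] arens_mult_apply)
qed (simp_all add: bidual_act_def)

lemma annihilator_bidual:
  assumes "F \<subseteq> dual_carrier A"
  shows "annihilator_space (dual A) F
    ((bidual A)\<lparr>carrier := {m \<in> dual_carrier (dual A). \<forall>f\<in>F. m f = 0}\<rparr>)"
  using assms by unfold_locales simp_all

lemma annihilator_bidual_UNIV: "annihilator_space (dual A) {} (bidual A)"
  by unfold_locales simp_all

lemma banach_algebra_bidual: "banach_algebra (bidual A)"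
proof (intro banach_algebra.intro banach_algebra_axioms.intro
    annihilator_space.banach[OF annihilator_bidual_UNIV])
  fix m n k z
  assume "m \<in> carrier (bidual A)" "n \<in> carrier (bidual A)"
  then have m: "m \<in> dual_carrier (dual A)" and n: "n \<in> dual_carrier (dual A)"
    by simp_all
  show "m \<otimes>\<^bsub>bidual A\<^esub> n \<in> carrier (bidual A)"
    "nrm (bidual A) (m \<otimes>\<^bsub>bidual A\<^esub> n) \<le> nrm (bidual A) m * nrm (bidual A) n"
    using arens_mult_closed[OF m n] by simp_all
  show "(z \<odot>\<^bsub>bidual A\<^esub> m) \<otimes>\<^bsub>bidual A\<^esub> n = z \<odot>\<^bsub>bidual A\<^esub> (m \<otimes>\<^bsub>bidual A\<^esub> n)"
    using bidual_act_closed(1)[OF n] by (auto simp: arens_mult_def)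
  have "bidual_act A (z \<odot>\<^bsub>bidual A\<^esub> n) f = z \<odot>\<^bsub>dual A\<^esub> bidual_act A n f"
    if "f \<in> dual_carrier A" for f
    using functional_act_closed(1)[OF that] by (auto simp: bidual_act_def)
  then show "m \<otimes>\<^bsub>bidual A\<^esub> (z \<odot>\<^bsub>bidual A\<^esub> n) = z \<odot>\<^bsub>bidual A\<^esub> (m \<otimes>\<^bsub>bidual A\<^esub> n)"
    using dual_carrierD(3)[OF m] bidual_act_closed(1)[OF n]
    by (auto simp: arens_mult_def simp del: dual_simps(4) bidual_simps(4)) 
      (auto simp: arens_mult_def)
  assume "k \<in> carrier (bidual A)"
  then have k: "k \<in> dual_carrier (dual A)"
    by simp
  show "m \<otimes>\<^bsub>bidual A\<^esub> n \<otimes>\<^bsub>bidual A\<^esub> k = m \<otimes>\<^bsub>bidual A\<^esub> (n \<otimes>\<^bsub>bidual A\<^esub> k)"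
    using bidual_act_arens[OF n k] bidual_act_closed(1)[OF k] by (auto simp: arens_mult_def)
  show "(m \<oplus>\<^bsub>bidual A\<^esub> n) \<otimes>\<^bsub>bidual A\<^esub> k = m \<otimes>\<^bsub>bidual A\<^esub> k \<oplus>\<^bsub>bidual A\<^esub> n \<otimes>\<^bsub>bidual A\<^esub> k"
    using bidual_act_closed(1)[OF k] by (auto simp: arens_mult_def)
  have "bidual_act A (n \<oplus>\<^bsub>bidual A\<^esub> k) f = bidual_act A n f \<oplus>\<^bsub>dual A\<^esub> bidual_act A k f"
    if "f \<in> dual_carrier A" for f
    using functional_act_closed(1)[OF that] by (auto simp: bidual_act_def)
  then show "m \<otimes>\<^bsub>bidual A\<^esub> (n \<oplus>\<^bsub>bidual A\<^esub> k) = m \<otimes>\<^bsub>bidual A\<^esub> n \<oplus>\<^bsub>bidual A\<^esub> m \<otimes>\<^bsub>bidual A\<^esub> k"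
    using dual_carrierD(2)[OF m] bidual_act_closed(1)[OF n] bidual_act_closed(1)[OF k]
    by (auto simp: arens_mult_def simp del: dual_simps(3) bidual_simps(3))
      (auto simp: arens_mult_def)
qed

end

section \<open>Complemented ideals of the second dual\<close>

context banach_algebra
begin

text \<open>Since \<pi> kills \<open>I\<close> and moves every element only by an element of
  \<open>I\<close>, both m - \<pi> m and \<pi> m - m are derivations into \<open>I\<close>, equal to
  the identity and to its negative on \<open>I\<close>. The elements \<xi> and \<eta> of the second
  dual of \<open>I\<close> that implement them recover \<phi>(i), up to sign, from the functionals j
  -> \<phi>(j i) and j -> \<phi>(i j) respectively.\<close>

lemma weak_star_ideal_identity:
  fixes F
  defines "I \<equiv> {m \<in> dual_carrier (dual A). \<forall>f\<in>F. m f = 0}"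
  assumes amenable: "amenable (bidual A)" and F: "F \<subseteq> dual_carrier A"
    and ideal: "\<And>m n. m \<in> I \<Longrightarrow> n \<in> dual_carrier (dual A) \<Longrightarrow>
      arens_mult A m n \<in> I \<and> arens_mult A n m \<in> I"
    and \<pi>: "bounded_hom (bidual A) \<pi>"
    and \<pi>_I: "\<And>m. m \<in> I \<Longrightarrow> \<pi> m = \<zero>\<^bsub>bidual A\<^esub>"
    and \<pi>_F: "\<And>m f. m \<in> dual_carrier (dual A) \<Longrightarrow> f \<in> F \<Longrightarrow> \<pi> m f = m f"
  shows "\<exists>p\<in>I. \<forall>m\<in>I. arens_mult A p m = m \<and> arens_mult A m p = m"
proof -
  define J where "J = (bidual A)\<lparr>carrier := I\<rparr>"
  interpret C: banach_algebra "bidual A"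
    by (rule banach_algebra_bidual)
  interpret C': annihilator_space "dual A" "{}" "bidual A"
    by (rule annihilator_bidual_UNIV)
  interpret J': annihilator_space "dual A" F J
    unfolding J_def I_def by (rule annihilator_bidual[OF F])
  note [simp del] = J'.carrier_Y J'.zero_Y J'.add_Y J'.smult_Y J'.nrm_Y
    C'.carrier_Y C'.zero_Y C'.add_Y C'.smult_Y C'.nrm_Y
  have J: "banach_space J"
    by (rule J'.banach)
  then interpret J: banach_space J .
  interpret J'': banach_space "dual J"
    by (rule J.banach_dual)
  have J_simps [simp]: "carrier J = I" "nrm J m = nrm (dual (dual A)) m"
    "x \<oplus>\<^bsub>J\<^esub> y = x \<oplus>\<^bsub>bidual A\<^esub> y" "z \<odot>\<^bsub>J\<^esub> x = z \<odot>\<^bsub>bidual A\<^esub> x" for m x y z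
    by (simp_all add: J_def)
  have I_sub: "m \<in> dual_carrier (dual A)" if "m \<in> I" for m
    using that by (simp add: I_def)
  have \<pi>_closed: "\<pi> m \<in> dual_carrier (dual A)" if "m \<in> dual_carrier (dual A)" for m
    using \<pi> that unfolding bounded_hom_def by auto
  have diff: "m \<ominus>\<^bsub>bidual A\<^esub> \<pi> m \<in> I" "\<pi> m \<ominus>\<^bsub>bidual A\<^esub> m \<in> I" if m: "m \<in> dual_carrier (dual A)" for m
  proof -
    have "m \<in> carrier (bidual A)" "\<pi> m \<in> carrier (bidual A)"
      using m \<pi>_closed by simp_all
    then show "m \<ominus>\<^bsub>bidual A\<^esub> \<pi> m \<in> I" "\<pi> m \<ominus>\<^bsub>bidual A\<^esub> m \<in> I"
      using C.minus_closed[of m "\<pi> m"] C.minus_closed[of "\<pi> m" m] \<pi>_F[OF m] F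
      by (auto simp: I_def C'.minus_apply subset_iff)
  qed
  have I_sub': "I \<subseteq> carrier (bidual A)"
    using I_sub by auto
  have ideal': "a \<otimes>\<^bsub>bidual A\<^esub> i \<in> I \<and> i \<otimes>\<^bsub>bidual A\<^esub> a \<in> I" if "a \<in> carrier (bidual A)" "i \<in> I" for a i
    using ideal that by simp
  obtain \<xi> where \<xi>: "\<xi> \<in> dual_carrier (dual J)"
    and \<xi>_eq: "\<And>m \<phi>. m \<in> dual_carrier (dual A) \<Longrightarrow> \<phi> \<in> dual_carrier J \<Longrightarrow>
      \<phi> (m \<ominus>\<^bsub>bidual A\<^esub> \<pi> m) = \<xi> (\<lambda>i\<in>I. \<phi> (arens_mult A (\<pi> m) i)) - \<xi> (\<lambda>i\<in>I. \<phi> (arens_mult A i m))"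
    using C.hom_difference_inner[OF amenable J[unfolded J_def] I_sub' ideal' \<pi> C.bounded_hom_id]
      diff(1) unfolding J_def[symmetric] by auto
  \<comment> \<open>The roles of \<pi> and the identity are exchanged: \<pi> now acts on the right,
    so the surviving term will be the one with left multiplication by m.\<close>
  obtain \<eta> where \<eta>: "\<eta> \<in> dual_carrier (dual J)"
    and \<eta>_eq: "\<And>m \<phi>. m \<in> dual_carrier (dual A) \<Longrightarrow> \<phi> \<in> dual_carrier J \<Longrightarrow>
      \<phi> (\<pi> m \<ominus>\<^bsub>bidual A\<^esub> m) = \<eta> (\<lambda>i\<in>I. \<phi> (arens_mult A m i)) - \<eta> (\<lambda>i\<in>I. \<phi> (arens_mult A i (\<pi> m)))"
    using C.hom_difference_inner[OF amenable J[unfolded J_def] I_sub' ideal' C.bounded_hom_id \<pi>]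
      diff(2) unfolding J_def[symmetric] by auto
  have zero: "\<phi> \<zero>\<^bsub>bidual A\<^esub> = 0" if "\<phi> \<in> dual_carrier J" for \<phi>
    using J.dual_zero[OF that] by (simp add: J_def)
  have mult_zero: "arens_mult A \<zero>\<^bsub>bidual A\<^esub> i = \<zero>\<^bsub>bidual A\<^esub>" "arens_mult A i \<zero>\<^bsub>bidual A\<^esub> = \<zero>\<^bsub>bidual A\<^esub>"
    if "i \<in> I" for i
    using C.mult_zero[of i] I_sub[OF that] by simp_all
  \<comment> \<open>Put m = i in \<open>\<xi>_eq\<close>; both terms that contain
    \<open>\<pi> i\<close> vanish.\<close>
  have left: "\<phi> i = - \<xi> (\<lambda>j\<in>I. \<phi> (arens_mult A j i))" if i: "i \<in> I" and \<phi>: "\<phi> \<in> dual_carrier J" for i \<phi>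
  proof -
    have "i \<ominus>\<^bsub>bidual A\<^esub> \<pi> i = i"
      unfolding \<pi>_I[OF i] using I_sub[OF i] C.r_zero[of i] C.zero_closed
      by (intro C.minus_unique) simp_all
    moreover have "(\<lambda>j\<in>I. \<phi> (arens_mult A (\<pi> i) j)) = \<zero>\<^bsub>dual J\<^esub>"
      using i by (intro dual_eqI[of _ J]) (simp_all add: \<pi>_I mult_zero zero[OF \<phi>] del: bidual_simps(2))
    ultimately show ?thesis
      using \<xi>_eq[OF I_sub[OF i] \<phi>] J''.dual_zero[OF \<xi>] by simp
  qed
  have right: "\<phi> i = - \<eta> (\<lambda>j\<in>I. \<phi> (arens_mult A i j))" if i: "i \<in> I" and \<phi>: "\<phi> \<in> dual_carrier J" for i \<phi>
  proof -
    have "\<pi> i \<ominus>\<^bsub>bidual A\<^esub> i = \<ominus>\<^bsub>bidual A\<^esub> i"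
      unfolding \<pi>_I[OF i] using I_sub[OF i] C.l_zero[of "\<ominus>\<^bsub>bidual A\<^esub> i"] C.a_inv_closed[of i]
      by (simp add: C.minus_eq)
    also have "\<dots> = (- 1) \<odot>\<^bsub>J\<^esub> i"
      using C.scale_minus_one[of i] I_sub[OF i] by simp
    finally have "\<phi> (\<pi> i \<ominus>\<^bsub>bidual A\<^esub> i) = - \<phi> i"
      using dual_carrierD(3)[OF \<phi>, of i "- 1"] i by simp
    moreover have "(\<lambda>j\<in>I. \<phi> (arens_mult A j (\<pi> i))) = \<zero>\<^bsub>dual J\<^esub>"
      using i by (intro dual_eqI[of _ J]) (simp_all add: \<pi>_I mult_zero zero[OF \<phi>] del: bidual_simps(2))
    ultimately show ?thesis
      using \<eta>_eq[OF I_sub[OF i] \<phi>] J''.dual_zero[OF \<eta>] by simp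
  qed
  \<comment> \<open>\<open>ev\<close> maps A' into the dual of \<open>I\<close>; composition with it
    carries the second dual of \<open>I\<close> back to A''.\<close>
  define ev where "ev f = (\<lambda>m\<in>I. m f)" for f
  have ev_bound: "cmod (ev f m) \<le> nrm (dual A) f * nrm J m" if "m \<in> carrier J" "f \<in> dual_carrier A" for f m
    using dual.dual_bound[of m f] that I_sub by (simp add: ev_def mult.commute)
  have ev_dual: "ev f \<in> dual_carrier J" if f: "f \<in> dual_carrier A" for f
  proof (rule dual_carrierI[OF _ _ _ ev_bound[OF _ f]])
    show "ev f (m \<oplus>\<^bsub>J\<^esub> n) = ev f m + ev f n" if "m \<in> carrier J" "n \<in> carrier J" for m n
      using J.a_closed[OF that] that f by (simp add: ev_def)
    show "ev f (c \<odot>\<^bsub>J\<^esub> m) = c * ev f m" if "m \<in> carrier J" for c m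
      using J.scale_closed[OF that, of c] that f by (simp add: ev_def)
  qed (auto simp: ev_def extensional_def)
  have ev_add: "ev (f \<oplus>\<^bsub>dual A\<^esub> g) = ev f \<oplus>\<^bsub>dual J\<^esub> ev g" if "f \<in> dual_carrier A" "g \<in> dual_carrier A" for f g
  proof (rule dual_eqI[of _ J])
    fix m assume "m \<in> carrier J"
    then show "ev (f \<oplus>\<^bsub>dual A\<^esub> g) m = (ev f \<oplus>\<^bsub>dual J\<^esub> ev g) m"
      using dual_carrierD(2)[OF I_sub, of m f g] that by (simp add: ev_def)
  qed (simp_all add: ev_def)
  have ev_scale: "ev (c \<odot>\<^bsub>dual A\<^esub> f) = c \<odot>\<^bsub>dual J\<^esub> ev f" if "f \<in> dual_carrier A" for c f
  proof (rule dual_eqI[of _ J])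
    fix m assume "m \<in> carrier J"
    then show "ev (c \<odot>\<^bsub>dual A\<^esub> f) m = (c \<odot>\<^bsub>dual J\<^esub> ev f) m"
      using dual_carrierD(3)[OF I_sub, of m f c] that by (simp add: ev_def)
  qed (simp_all add: ev_def)
  \<comment> \<open>The sign cancels the one in \<open>left\<close>. That p lies in \<open>I\<close>
    will follow from \<open>ev f\<close> being 0 for f in \<open>F\<close>.\<close>
  define p where "p = (\<lambda>f\<in>dual_carrier A. - \<xi> (ev f))"
  have "p \<in> dual_carrier (dual A)"
  proof (rule dual_carrierI)
    show "p (f \<oplus>\<^bsub>dual A\<^esub> g) = p f + p g" if "f \<in> carrier (dual A)" "g \<in> carrier (dual A)" for f g
      using that dual.a_closed[OF that] dual_carrierD(2)[OF \<xi>, of "ev f" "ev g"] ev_dual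
      by (simp add: p_def ev_add del: dual_simps(3))
    show "p (c \<odot>\<^bsub>dual A\<^esub> f) = c * p f" if "f \<in> carrier (dual A)" for c f
      using that dual.scale_closed[OF that, of c] dual_carrierD(3)[OF \<xi>, of "ev f" c] ev_dual
      by (simp add: p_def ev_scale del: dual_simps(4))
    show "cmod (p f) \<le> nrm (dual (dual J)) \<xi> * nrm (dual A) f" if "f \<in> carrier (dual A)" for f
    proof -
      have f: "f \<in> dual_carrier A"
        using that by simp
      have "nrm (dual J) (ev f) \<le> nrm (dual A) f"
        using ev_bound[OF _ f] dual_nrm_nonneg[OF f] by (intro J.dual_nrm_le) auto
      then show ?thesis
        using J''.dual_bound[OF \<xi>, of "ev f"] ev_dual[OF f] f
          mult_left_mono[OF _ J''.dual_nrm_nonneg[OF \<xi>], of "nrm (dual J) (ev f)" "nrm (dual A) f"]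
        by (simp add: p_def)
    qed
  qed (simp add: p_def)
  moreover have "p f = 0" if "f \<in> F" for f
  proof -
    have "ev f = \<zero>\<^bsub>dual J\<^esub>"
      using that by (intro dual_eqI[of _ J]) (simp_all add: ev_def I_def)
    then show ?thesis
      using that F J''.dual_zero[OF \<xi>] by (auto simp: p_def)
  qed
  ultimately have pI: "p \<in> I"
    by (simp add: I_def)
  have pi: "arens_mult A p i = i" if i: "i \<in> I" for i
  proof (rule dual_eqI[of _ "dual A"])
    fix f assume "f \<in> carrier (dual A)"
    then have f: "f \<in> dual_carrier A"
      by simp
    \<comment> \<open>By j(i.f) = (j i)(f), the functional at which \<open>left\<close> evaluates
      \<xi> is again \<open>ev\<close> of an element of A'. This fails to be available for j -> (i
      j)(f), which need not come from A'.\<close>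
    have "ev (bidual_act A i f) = (\<lambda>j\<in>I. ev f (arens_mult A j i))"
      using i f ideal I_sub by (auto simp: ev_def arens_mult_apply)
    then have "arens_mult A p i f = ev f i"
      using bidual_act_closed(1)[OF I_sub[OF i] f] left[OF i ev_dual[OF f]]
      by (simp add: arens_mult_apply[OF f]) (simp add: p_def)
    then show "arens_mult A p i f = i f"
      using i by (simp add: ev_def)
  qed (use i I_sub dual_carrierD(1)[of _ "dual A"] in \<open>auto simp: arens_mult_def\<close>)
  have "arens_mult A i p = i" if i: "i \<in> I" for i
  proof (rule dual_eqI[of _ "dual A"])
    have ip: "arens_mult A i p \<in> I"
      using ideal[OF i I_sub[OF pI]] by simp
    fix f assume "f \<in> carrier (dual A)"
    then have f: "f \<in> dual_carrier A"
      by simp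
    \<comment> \<open>\<open>right\<close> depends on an element of \<open>I\<close> only through
      its products with all j in \<open>I\<close> from the right, and these agree for i p and
      i.\<close>
    have "arens_mult A (arens_mult A i p) j = arens_mult A i j" if "j \<in> I" for j
      using C.mult_assoc[of i p j] I_sub pI i that pi[OF that] by simp
    then have "ev f (arens_mult A i p) = ev f i"
      unfolding right[OF ip ev_dual[OF f]] right[OF i ev_dual[OF f]]
      by (intro arg_cong[where f = "\<lambda>x. - \<eta> x"] restrict_ext) simp
    then show "arens_mult A i p f = i f"
      using i ip by (simp add: ev_def)
  qed (use i I_sub dual_carrierD(1)[of _ "dual A"] in \<open>auto simp: arens_mult_def\<close>)
  then show ?thesis
    using pI pi by blast
qed

text \<open>For every p the map n -> n p is weak-star continuous, its coordinate at f being
  evaluation of n at p.f. Centrality turns it into n -> p n, the map that the first topological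
  center is about.\<close>

lemma central_in_topological_center:
  assumes p: "p \<in> dual_carrier (dual A)"
    and central: "\<And>n. n \<in> dual_carrier (dual A) \<Longrightarrow> arens_mult A p n = arens_mult A n p"
  shows "p \<in> first_topological_center A"
proof -
  have top: "topspace (weak_star (dual A)) = dual_carrier (dual A)"
    using dual_carrierD(1)[of _ "dual A"] unfolding weak_star_def by (fastforce simp: PiE_iff)
  have "continuous_map (weak_star (dual A)) (weak_star (dual A)) (\<lambda>n. arens_mult A n p)"
    unfolding weak_star_def continuous_map_in_subtopology continuous_map_componentwise
  proof (intro conjI ballI)
    fix f assume "f \<in> carrier (dual A)"
    then have f: "f \<in> dual_carrier A" "bidual_act A p f \<in> carrier (dual A)"
      using bidual_act_closed(1)[OF p] by simp_all
    show "continuous_map (subtopology (product_topology (\<lambda>_. euclidean) (carrier (dual A)))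
        (carrier (dual (dual A)))) euclidean (\<lambda>n. arens_mult A n p f)"
      unfolding arens_mult_apply[OF f(1)]
      by (intro continuous_map_from_subtopology continuous_map_product_projection f(2))
  qed (use arens_mult_closed(1)[OF _ p] in \<open>auto simp: arens_mult_def\<close>)
  then have "continuous_map (weak_star (dual A)) (weak_star (dual A)) (\<lambda>n. arens_mult A p n)"
    by (rule continuous_map_eq) (simp add: top central)
  then show ?thesis
    using p by (simp add: first_topological_center_def)
qed

text \<open>An identity \<open>p\<close> of an ideal is central: \<open>pn\<close> and \<open>np\<close> lie in the ideal, so that
  \<open>pn = pnp = np\<close>.\<close>

lemma complemented_ideal_identity:
  fixes F
  defines "I \<equiv> {m \<in> dual_carrier (dual A). \<forall>f\<in>F. m f = 0}"
  assumes "left_strongly_arens_irregular A" "amenable (bidual A)" "F \<subseteq> dual_carrier A"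
    and ideal: "\<And>m n. m \<in> I \<Longrightarrow> n \<in> dual_carrier (dual A) \<Longrightarrow>
      arens_mult A m n \<in> I \<and> arens_mult A n m \<in> I"
    and "bounded_hom (bidual A) \<pi>"
    and "\<And>m. m \<in> I \<Longrightarrow> \<pi> m = \<zero>\<^bsub>bidual A\<^esub>"
    and "\<And>m f. m \<in> dual_carrier (dual A) \<Longrightarrow> f \<in> F \<Longrightarrow> \<pi> m f = m f"
  shows "\<exists>a\<in>carrier A. canonical_embedding A a \<in> I \<and>
    (\<forall>m\<in>I. arens_mult A (canonical_embedding A a) m = m \<and> arens_mult A m (canonical_embedding A a) = m)"
proof -
  interpret C: banach_algebra "bidual A"
    by (rule banach_algebra_bidual)
  obtain p where p: "p \<in> I" and id: "\<And>m. m \<in> I \<Longrightarrow> arens_mult A p m = m"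
    "\<And>m. m \<in> I \<Longrightarrow> arens_mult A m p = m"
    using weak_star_ideal_identity[OF assms(3,4,5,6,7,8)[unfolded I_def]] unfolding I_def by blast
  have pC: "p \<in> dual_carrier (dual A)"
    using p by (simp add: I_def)
  have "arens_mult A p n = arens_mult A n p" if n: "n \<in> dual_carrier (dual A)" for n
    using id(2)[of "arens_mult A p n"] id(1)[of "arens_mult A n p"] ideal[OF p n]
      C.mult_assoc[of p n p] pC n by simp
  then have "p \<in> canonical_embedding A ` carrier A"
    using central_in_topological_center[OF pC] assms(2)
    by (simp add: left_strongly_arens_irregular_def)
  then show ?thesis
    using p id by blast
qed

section \<open>The canonical embedding as a homomorphism of algebras\<close>

lemma canonical_embedding_closed: "a \<in> carrier A \<Longrightarrow> canonical_embedding A a \<in> dual_carrier (dual A)"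
  and canonical_embedding_nrm: "a \<in> carrier A \<Longrightarrow> nrm (dual (dual A)) (canonical_embedding A a) \<le> nrm A a"
proof -
  assume a: "a \<in> carrier A"
  have *: "cmod (canonical_embedding A a f) \<le> nrm A a * nrm (dual A) f" if "f \<in> carrier (dual A)" for f
    using dual_bound[of f a] that a by (simp add: canonical_embedding_def mult.commute)
  show "canonical_embedding A a \<in> dual_carrier (dual A)"
  proof (rule dual_carrierI[OF _ _ _ *])
    show "canonical_embedding A a (f \<oplus>\<^bsub>dual A\<^esub> g) = canonical_embedding A a f + canonical_embedding A a g"
      if "f \<in> carrier (dual A)" "g \<in> carrier (dual A)" for f g
      using dual.a_closed[OF that] that a by (simp add: canonical_embedding_def)
    show "canonical_embedding A a (c \<odot>\<^bsub>dual A\<^esub> f) = c * canonical_embedding A a f"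
      if "f \<in> carrier (dual A)" for f c
      using dual.scale_closed[OF that, of c] that a by (simp add: canonical_embedding_def)
  qed (auto simp: canonical_embedding_def extensional_def)
  show "nrm (dual (dual A)) (canonical_embedding A a) \<le> nrm A a"
    using * nrm_nonneg[OF a] by (intro dual.dual_nrm_le) auto
qed

text \<open>On elements of A the action used in the Arens product is the left module action on A'.
  This yields multiplicativity of the embedding.\<close>

lemma bidual_act_canonical_embedding:
  assumes "b \<in> carrier A" "f \<in> dual_carrier A"
  shows "bidual_act A (canonical_embedding A b) f = dual_left A (\<otimes>) b f"
proof (rule dual_eqI[of _ A])
  fix a assume a: "a \<in> carrier A"
  then have "bidual_act A (canonical_embedding A b) f a = functional_act A f a b"
    using functional_act_closed(1)[OF assms(2) a] by (simp add: bidual_act_def canonical_embedding_def)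
  then show "bidual_act A (canonical_embedding A b) f a = dual_left A (\<otimes>) b f a"
    using a assms by (simp add: functional_act_def dual_left_def)
qed (simp_all add: bidual_act_def dual_left_def)

lemma canonical_embedding_mult:
  assumes "a \<in> carrier A" "b \<in> carrier A"
  shows "arens_mult A (canonical_embedding A a) (canonical_embedding A b) = canonical_embedding A (a \<otimes> b)"
proof (rule dual_eqI[of _ "dual A"])
  fix f assume "f \<in> carrier (dual A)"
  then have f: "f \<in> dual_carrier A"
    by simp
  show "arens_mult A (canonical_embedding A a) (canonical_embedding A b) f = canonical_embedding A (a \<otimes> b) f"
    using assms f bidual_act_closed(1)[OF canonical_embedding_closed f, of b]
    by (simp add: arens_mult_apply bidual_act_canonical_embedding)
      (simp add: canonical_embedding_def dual_left_def)
qed (simp_all add: arens_mult_def canonical_embedding_def)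

text \<open>The Hahn--Banach theorem enters here. It lets equations that hold in the second dual
  descend to A.\<close>

lemma canonical_embedding_inj:
  assumes "a \<in> carrier A" "b \<in> carrier A" "canonical_embedding A a = canonical_embedding A b"
  shows "a = b"
proof (rule ccontr)
  assume "a \<noteq> b"
  then have "a \<ominus> b \<noteq> \<zero>"
    using assms(1,2) minus_add_cancel[of a b] by auto
  then obtain f where f: "f \<in> dual_carrier A" "f (a \<ominus> b) \<noteq> 0"
    using dual_separates[of "a \<ominus> b"] assms by auto
  have "f a = f (a \<ominus> b) + f b"
    using dual_carrierD(2)[OF f(1), of "a \<ominus> b" b] assms(1,2) by (simp add: minus_add_cancel)
  moreover have "f a = f b"
    using fun_cong[OF assms(3), of f] f by (simp add: canonical_embedding_def)
  ultimately show False
    using f by simp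
qed

section \<open>The two assertions\<close>

theorem identity_exists:
  assumes "left_strongly_arens_irregular A" "amenable (bidual A)"
  shows "\<exists>e\<in>carrier A. \<forall>a\<in>carrier A. e \<otimes> a = a \<and> a \<otimes> e = a"
proof -
  interpret C: banach_algebra "bidual A"
    by (rule banach_algebra_bidual)
  have "\<exists>e\<in>carrier A. canonical_embedding A e \<in> {m \<in> dual_carrier (dual A). \<forall>f\<in>{}. m f = 0} \<and>
      (\<forall>m\<in>{m \<in> dual_carrier (dual A). \<forall>f\<in>{}. m f = 0}.
        arens_mult A (canonical_embedding A e) m = m \<and> arens_mult A m (canonical_embedding A e) = m)"
    \<comment> \<open>For empty \<open>F\<close> the ideal is all of A'' and its complement is 0, so
      \<pi> is the zero homomorphism.\<close>
    by (rule complemented_ideal_identity[OF assms _ _ C.bounded_hom_zero])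
      (simp_all add: arens_mult_closed(1))
  then obtain e where e: "e \<in> carrier A"
    and id: "\<And>m. m \<in> dual_carrier (dual A) \<Longrightarrow> arens_mult A (canonical_embedding A e) m = m \<and>
      arens_mult A m (canonical_embedding A e) = m"
    by auto
  have "e \<otimes> a = a \<and> a \<otimes> e = a" if "a \<in> carrier A" for a
    using e that id[OF canonical_embedding_closed[OF that]]
    by (auto simp: canonical_embedding_mult mult_closed intro: canonical_embedding_inj)
  then show ?thesis
    using e by blast
qed

text \<open>Every m in A'' agrees on \<open>F\<close> with exactly one element \<open>b m\<close> of
  A. Hence A'' is the sum of the copy of A and the ideal \<open>I\<close>, and reflexivity amounts
  to \<open>I\<close> being 0. The identity of \<open>I\<close> lies in both summands, which forces
  it to be 0.\<close>

theorem reflexive_if_predual: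
  assumes lsai: "left_strongly_arens_irregular A" and amenable: "amenable (bidual A)"
    and predual: "is_predual A A (\<otimes>) (\<otimes>) F"
  shows "reflexive A"
proof -
  define F' where "F' = (dual A)\<lparr>carrier := F\<rparr>"
  define \<iota> where "\<iota> x = (\<lambda>f\<in>F. f x)" for x :: 'a
  define I where "I = {m \<in> dual_carrier (dual A). \<forall>f\<in>F. m f = 0}"
  interpret C: banach_algebra "bidual A"
    by (rule banach_algebra_bidual)
  have F: "submodule F complex_ring (dual A)"
    using predual by (simp add: is_predual_def)
  have F_dual: "f \<in> dual_carrier A" if "f \<in> F" for f
    using dual.submoduleE(1)[OF F] that by auto
  have F_zero: "\<zero>\<^bsub>dual A\<^esub> \<in> F"
    using subgroup.one_closed[OF submodule.axioms(1)[OF F]] by simp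
  have F_left: "dual_left A (\<otimes>) a f \<in> F" and F_right: "functional_act A f a \<in> F"
    if "a \<in> carrier A" "f \<in> F" for a f
    using predual that by (simp_all add: is_predual_def functional_act_def dual_right_def)
  have bij: "bij_betw \<iota> (carrier A) (dual_carrier F')"
    and iso: "\<exists>K. \<forall>x\<in>carrier A. nrm A x \<le> K * nrm (dual F') (\<iota> x)"
    using predual by (simp_all add: is_predual_def Let_def \<iota>_def[abs_def] F'_def)
  obtain K where K: "\<And>x. x \<in> carrier A \<Longrightarrow> nrm A x \<le> K * nrm (dual F') (\<iota> x)"
    using iso by blast
  have F'_simps [simp]: "carrier F' = F" "f \<oplus>\<^bsub>F'\<^esub> g = f \<oplus>\<^bsub>dual A\<^esub> g" "c \<odot>\<^bsub>F'\<^esub> f = c \<odot>\<^bsub>dual A\<^esub> f"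
    "nrm F' f = nrm (dual A) f" for f g c
    by (simp_all add: F'_def)
  have restrict_closed: "restrict m F \<in> dual_carrier F'" if m: "m \<in> dual_carrier (dual A)" for m
  proof (rule dual_carrierI)
    show "restrict m F (f \<oplus>\<^bsub>F'\<^esub> g) = restrict m F f + restrict m F g"
      if "f \<in> carrier F'" "g \<in> carrier F'" for f g
      using that dual.submoduleE(5)[OF F, of f g] F_dual dual_carrierD(2)[OF m, of f g] by simp
    show "restrict m F (c \<odot>\<^bsub>F'\<^esub> f) = c * restrict m F f" if "f \<in> carrier F'" for c f
      using that dual.submoduleE(4)[OF F, of c f] F_dual dual_carrierD(3)[OF m, of f c] by simp
    show "cmod (restrict m F f) \<le> nrm (dual (dual A)) m * nrm F' f" if "f \<in> carrier F'" for f
      using that dual.dual_bound[OF m, of f] F_dual by simp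
  qed simp
  define b where "b m = inv_into (carrier A) \<iota> (restrict m F)" for m
  have b_closed: "b m \<in> carrier A" and \<iota>_b: "\<iota> (b m) = restrict m F"
    if "m \<in> dual_carrier (dual A)" for m
    using bij restrict_closed[OF that] unfolding b_def bij_betw_def
    by (auto intro: inv_into_into f_inv_into_f)
  have b_apply: "f (b m) = m f" if "m \<in> dual_carrier (dual A)" "f \<in> F" for m f
    using fun_cong[OF \<iota>_b[OF that(1)], of f] that(2) by (simp add: \<iota>_def)
  \<comment> \<open>Injectivity of \<iota> says that \<open>F\<close> separates the points of A;
    every identity for \<open>b\<close> below is checked on \<open>F\<close> in this way.\<close>
  have b_eqI: "b m = a" if "m \<in> dual_carrier (dual A)" "a \<in> carrier A" "\<And>f. f \<in> F \<Longrightarrow> m f = f a" for m a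
  proof -
    have "\<iota> (b m) = \<iota> a"
      using that(3) by (simp add: \<iota>_b[OF that(1)] \<iota>_def[of a] restrict_def fun_eq_iff)
    then show ?thesis
      using bij b_closed[OF that(1)] that(2) unfolding bij_betw_def by (blast dest: inj_onD)
  qed
  \<comment> \<open>(n.f)(a) = n(f.a), and f.a stays in the submodule \<open>F\<close>, where n may
    be replaced by \<open>b n\<close>. As n.f is then in \<open>F\<close> too, the same replacement
    applies to m in (m n)(f) = m(n.f), which makes \<open>b\<close> multiplicative.\<close>
  have bidual_act_F: "bidual_act A n f = dual_left A (\<otimes>) (b n) f"
    if n: "n \<in> dual_carrier (dual A)" and f: "f \<in> F" for n f
  proof (rule dual_eqI[of _ A])
    fix a assume a: "a \<in> carrier A"
    then show "bidual_act A n f a = dual_left A (\<otimes>) (b n) f a"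
      using b_apply[OF n F_right[OF a f]] b_closed[OF n]
      by (simp add: bidual_act_def dual_left_def) (simp add: functional_act_def)
  qed (simp_all add: bidual_act_def dual_left_def)
  define \<pi> where "\<pi> m = canonical_embedding A (b m)" for m
  have \<pi>_F: "\<pi> m f = m f" if "m \<in> dual_carrier (dual A)" "f \<in> F" for m f
    using that b_apply F_dual by (simp add: \<pi>_def canonical_embedding_def)
  have "bounded_hom (bidual A) \<pi>"
    unfolding bounded_hom_def
  proof (intro conjI ballI allI)
    show "\<pi> \<in> carrier (bidual A) \<rightarrow> carrier (bidual A)"
      using canonical_embedding_closed[OF b_closed] by (simp add: \<pi>_def)
    have "nrm (dual (dual A)) (\<pi> m) \<le> \<bar>K\<bar> * nrm (dual (dual A)) m"
      if m: "m \<in> dual_carrier (dual A)" for m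
    proof -
      \<comment> \<open>Restriction to \<open>F\<close> does not increase the norm, seen directly on
        the suprema. The zero functional makes the set nonempty and the supremum nonnegative, which
        permits replacing K by its absolute value.\<close>
      let ?B = "{f \<in> F. nrm (dual A) f \<le> 1}" and ?h = "\<lambda>f. cmod (restrict m F f)"
      have nrm: "nrm (dual F') (restrict m F) = Sup (?h ` ?B)"
        unfolding dual_def[of F'] by simp
      have zero: "\<zero>\<^bsub>dual A\<^esub> \<in> ?B"
        using F_zero dual.nrm_zero by auto
      have le: "?h f \<le> nrm (dual (dual A)) m" if "f \<in> ?B" for f
        using that dual.dual_bound[OF m, of f] F_dual[of f]
          mult_left_mono[OF _ dual.dual_nrm_nonneg[OF m], of "nrm (dual A) f" 1] by simp
      have "nrm (dual F') (restrict m F) \<le> nrm (dual (dual A)) m"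
        unfolding nrm using zero le by (intro cSUP_least) blast+
      moreover have "0 \<le> nrm (dual F') (restrict m F)"
        unfolding nrm
        by (rule order_trans[OF norm_ge_zero cSUP_upper[OF zero]]) (rule bdd_aboveI2[OF le])
      ultimately have "K * nrm (dual F') (\<iota> (b m)) \<le> \<bar>K\<bar> * nrm (dual (dual A)) m"
        unfolding \<iota>_b[OF m] by (intro mult_mono) auto
      then show ?thesis
        using canonical_embedding_nrm[OF b_closed[OF m]] K[OF b_closed[OF m]]
        unfolding \<pi>_def by linarith
    qed
    then show "\<exists>K. \<forall>m\<in>carrier (bidual A). nrm (bidual A) (\<pi> m) \<le> K * nrm (bidual A) m"
      by auto
    fix m n z assume "m \<in> carrier (bidual A)" "n \<in> carrier (bidual A)"
    then have m: "m \<in> dual_carrier (dual A)" and n: "n \<in> dual_carrier (dual A)"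
      by simp_all
    have "b (m \<oplus>\<^bsub>bidual A\<^esub> n) = b m \<oplus> b n"
    proof (rule b_eqI)
      show "(m \<oplus>\<^bsub>bidual A\<^esub> n) f = f (b m \<oplus> b n)" if "f \<in> F" for f
        using b_apply[OF m that] b_apply[OF n that] F_dual[OF that]
          dual_carrierD(2)[OF F_dual[OF that] b_closed[OF m] b_closed[OF n]] by simp
    qed (use C.a_closed[of m n] m n b_closed in auto)
    then show "\<pi> (m \<oplus>\<^bsub>bidual A\<^esub> n) = \<pi> m \<oplus>\<^bsub>bidual A\<^esub> \<pi> n"
      using b_closed m n by (auto simp: \<pi>_def canonical_embedding_def dual_carrierD(2))
    have "b (z \<odot>\<^bsub>bidual A\<^esub> m) = z \<odot> b m"
    proof (rule b_eqI)
      show "(z \<odot>\<^bsub>bidual A\<^esub> m) f = f (z \<odot> b m)" if "f \<in> F" for f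
        using b_apply[OF m that] F_dual[OF that]
          dual_carrierD(3)[OF F_dual[OF that] b_closed[OF m]] by simp
    qed (use C.scale_closed[of m z] m b_closed in auto)
    then show "\<pi> (z \<odot>\<^bsub>bidual A\<^esub> m) = z \<odot>\<^bsub>bidual A\<^esub> \<pi> m"
      using b_closed m by (auto simp: \<pi>_def canonical_embedding_def dual_carrierD(3))
    have "b (arens_mult A m n) = b m \<otimes> b n"
    proof (rule b_eqI)
      fix f assume f: "f \<in> F"
      show "arens_mult A m n f = f (b m \<otimes> b n)"
        using b_apply[OF m F_left[OF b_closed[OF n] f]] b_closed m n F_dual[OF f]
        by (simp add: arens_mult_apply bidual_act_F[OF n f]) (simp add: dual_left_def)
    qed (use arens_mult_closed m n b_closed mult_closed in auto)
    then show "\<pi> (m \<otimes>\<^bsub>bidual A\<^esub> n) = \<pi> m \<otimes>\<^bsub>bidual A\<^esub> \<pi> n"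
      using b_closed m n by (simp add: \<pi>_def canonical_embedding_mult)
  qed
  moreover have "\<pi> m = \<zero>\<^bsub>bidual A\<^esub>" if "m \<in> I" for m
  proof -
    have "b m = \<zero>"
      using that dual_zero[OF F_dual] by (intro b_eqI) (auto simp: I_def)
    then show ?thesis
      using dual_zero by (auto simp: \<pi>_def canonical_embedding_def)
  qed
  \<comment> \<open>For f in \<open>F\<close>, the functional n.f lies in \<open>F\<close> and is
    killed by m; and m.f is 0 because m kills every f.a.\<close>
  moreover have "arens_mult A m n \<in> I \<and> arens_mult A n m \<in> I"
    if m: "m \<in> I" and n: "n \<in> dual_carrier (dual A)" for m n
  proof -
    have mC: "m \<in> dual_carrier (dual A)"
      using m by (simp add: I_def)
    have "arens_mult A m n f = 0" if f: "f \<in> F" for f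
      using m F_left[OF b_closed[OF n] f]
      by (simp add: arens_mult_apply[OF F_dual[OF f]] bidual_act_F[OF n f] I_def)
    moreover have "arens_mult A n m f = 0" if f: "f \<in> F" for f
    proof -
      have "bidual_act A m f = \<zero>\<^bsub>dual A\<^esub>"
        using m F_right[OF _ f] by (auto simp: bidual_act_def I_def)
      then show ?thesis
        using dual.dual_zero[OF n] by (simp add: arens_mult_apply[OF F_dual[OF f]])
    qed
    ultimately show ?thesis
      using arens_mult_closed(1) mC n by (simp add: I_def)
  qed
  ultimately obtain e where e: "e \<in> carrier A" "canonical_embedding A e \<in> I"
    and id: "\<And>m. m \<in> I \<Longrightarrow> arens_mult A (canonical_embedding A e) m = m"
    using complemented_ideal_identity[OF lsai amenable, of F \<pi>, folded I_def] F_dual \<pi>_F by blast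
  have "f e = 0" if "f \<in> F" for f
  proof -
    have "canonical_embedding A e f = 0"
      using e(2) that by (simp add: I_def)
    then show ?thesis
      using F_dual[OF that] by (simp add: canonical_embedding_def)
  qed
  \<comment> \<open>Both e and \<open>\<zero>\<close> represent the zero functional on
    \<open>F\<close>, so they coincide.\<close>
  then have "b \<zero>\<^bsub>bidual A\<^esub> = e" "b \<zero>\<^bsub>bidual A\<^esub> = \<zero>"
    using e(1) C.zero_closed F_dual dual_zero by (auto intro!: b_eqI)
  then have e0: "canonical_embedding A e = \<zero>\<^bsub>bidual A\<^esub>"
    using dual_zero by (auto simp: canonical_embedding_def)
  have "m = canonical_embedding A (b m)" if m: "m \<in> dual_carrier (dual A)" for m
  proof -
    have \<pi>m: "\<pi> m \<in> dual_carrier (dual A)"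
      using canonical_embedding_closed[OF b_closed[OF m]] by (simp add: \<pi>_def)
    interpret C': annihilator_space "dual A" "{}" "bidual A"
      by (rule annihilator_bidual_UNIV)
    \<comment> \<open>As an element of \<open>I\<close> this difference equals its product with the
      identity of \<open>I\<close>, which is 0 by \<open>e0\<close>.\<close>
    have "m \<ominus>\<^bsub>bidual A\<^esub> \<pi> m \<in> I"
      using C.minus_closed[of m "\<pi> m"] m \<pi>m \<pi>_F[OF m] F_dual by (simp add: I_def C'.minus_apply)
    then have "m \<ominus>\<^bsub>bidual A\<^esub> \<pi> m = \<zero>\<^bsub>bidual A\<^esub>"
      using id[of "m \<ominus>\<^bsub>bidual A\<^esub> \<pi> m"] C.mult_zero(1)[of "m \<ominus>\<^bsub>bidual A\<^esub> \<pi> m"] C.minus_closed[of m "\<pi> m"] m \<pi>m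
      unfolding e0 by simp
    then show ?thesis
      using C.minus_add_cancel[of m "\<pi> m"] C.l_zero[of "\<pi> m"] m \<pi>m unfolding \<pi>_def by simp
  qed
  then show ?thesis
    using canonical_embedding_closed b_closed unfolding reflexive_def by auto
qed

end

theorem theorem3p7:
  fixes A :: "'a normed_module"
  assumes "banach_algebra A"
    and "left_strongly_arens_irregular A"
    and "amenable (bidual A)"
  shows "(\<exists>e\<in>carrier A. \<forall>a\<in>carrier A. e \<otimes>\<^bsub>A\<^esub> a = a \<and> a \<otimes>\<^bsub>A\<^esub> e = a) \<and>
         (dual_banach_algebra A \<longrightarrow> reflexive A)"
  using banach_algebra.identity_exists[OF assms] banach_algebra.reflexive_if_predual[OF assms]
  by (auto simp: dual_banach_algebra_def dual_bimodule_def)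

end
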